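(* If $\mathcal{K}$ is an abstract elementary class (AEC) with intersections, $\operatorname{LS}(\mathcal{K})=\aleph_0$, and $\mathbb{I}(\mathcal{K},\aleph_0)\le\aleph_0$, then $\mathcal{K}$ has a Borel functorial expansion (so in particular, $\mathcal{K}$ is analytically presented).
   Context: Number of models: $\mathbb{I}(\mathcal{K},\aleph_0)$ denotes the number of isomorphism types of models in $\mathcal{K}$ of cardinality $\aleph_0$. Structures: vocabularies are finitary; structures are allowed to have empty universe (when the vocabulary has no constant symbols). $|M|$ is the universe of $M$ and $\|M\|$ its cardinality. AEC: an abstract elementary class is a pair $\mathcal{K}=(K,\le_{\mathcal{K}})$ such that: (1) $K$ is a class of structures in a fixed vocabulary $\tau(\mathcal{K})$, $\le_{\mathcal{K}}$ is a partial order on $K$, $M\le_{\mathcal{K}} N$ implies $M\subseteq N$ (substructure), and $K$ and $\le_{\mathcal{K}}$ are closed under isomorphisms; (2) coherence: if $M_0,M_1,M_2\in K$, $M_0\subseteq M_1\le_{\mathcal{K}} M_2$ and $M_0\le_{\mathcal{K}} M_2$, then $M_0\le_{\mathcal{K}} M_1$; (3) Tarski–Vaught chain axioms: if $\delta$ is a limit ordinal, $\langle M_i:i<\delta\rangle$ is $\le_{\mathcal{K}}$-increasing and $M=\bigcup_{i<\delta}M_i$, then $M\in K$, $M_0\le_{\mathcal{K}} M$, and if $N\in K$ satisfies $M_i\le_{\mathcal{K}} N$ for all $i<\delta$ then $M\le_{\mathcal{K}} N$; (4) Löwenheim–Skolem–Tarski axiom: there is a cardinal $\lambda\ge|\tau(\mathcal{K})|+\aleph_0$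 such that for every $N\in K$ and $A\subseteq|N|$ there is $M\in K$ with $A\subseteq|M|$, $M\le_{\mathcal{K}} N$ and $\|M\|\le|A|+\lambda$. The least such $\lambda$ is $\operatorname{LS}(\mathcal{K})$. Intersections: for $N\in K$ and $A\subseteq|N|$, $c\ell^N(A)$ is the intersection of all (universes of) $N_0\le_{\mathcal{K}} N$ with $A\subseteq|N_0|$, also viewed as a substructure of $N$. $\mathcal{K}$ has intersections if $c\ell^N(A)\le_{\mathcal{K}} N$ for all $N\in K$ and $A\subseteq|N|$. Functorial expansion: a functorial expansion of an AEC $\mathcal{K}$ is a class $K^+$ of structures in a vocabulary $\tau(K^+)\supseteq\tau(\mathcal{K})$ (finitary) such that the reduct map $M\mapsto M\restriction\tau(\mathcal{K})$ is a structure-preserving bijection from $K^+$ onto $K$: any isomorphism between two members of $K$ is also an isomorphism between their expansions in $K^+$, and if $M\le_{\mathcal{K}} N$ then the expansion of $M$ is a substructure of the expansion of $N$. One sets $\mathcal{K}^+=(K^+,\le_{\mathcal{K}^+})$ where $M\le_{\mathcal{K}^+}N$ iff $M\restriction\tau(\mathcal{K})\le_{\mathcal{K}} N\restriction\tau(\mathcal{K})$; $\mathcal{K}^+$ is also called a functorial expansion of $\mathcal{K}$. Borel / analytically presented: $\mathcal{K}_{\le\aleph_0}$ is the restriction of $\mathcal{K}$ to its models of cardinality at most $\aleph_0$. Such models are thought of as reals, e.g. via the standard Borel space of structures (in a countable vocabulary) with universe a subset of $\omega$. An AEC $\mathcal{K}$ is Borel (or Borel presented) if $\operatorname{LS}(\mathcal{K})=\aleph_0$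 and $\mathcal{K}_{\le\aleph_0}$ is Borel, meaning that both the set of (codes for) members of $\mathcal{K}_{\le\aleph_0}$ and the ordering relation $\le_{\mathcal{K}}$ on them are Borel. It is analytically presented if $\operatorname{LS}(\mathcal{K})=\aleph_0$ and $\mathcal{K}_{\le\aleph_0}$ is analytic, in the same sense.
   Formalization: The formal theorem additionally assumes that K has at most countably many isomorphism types of finite models; without this the claim fails (one-point structures in countably many unary predicates whose patterns form a non-analytic set, ordered by equality). *)

theory Defs
  imports "HOL-Analysis.Analysis"
begin

unbundle cardinal_syntax

section \<open>Structures\<close>

text \<open>A symbol outside the domain of the map does not belong to the vocabulary. Constants are
  function symbols of arity 0.\<close>

datatype symbol_kind = Rel nat | Fun nat

type_synonym 's vocab = "'s \<Rightarrow> symbol_kind option"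

record ('u, 's) struct =
  univ :: "'u set"
  rels :: "'s \<Rightarrow> 'u list set"
  funs :: "'s \<Rightarrow> 'u list \<Rightarrow> 'u"

text \<open>Interpretations are normalised where they carry no information, so that equality of
  structures is the intended one. The universe may be empty; by the closure condition at the empty
  list it is nonempty as soon as there is a constant.\<close>

definition structures :: "'s vocab \<Rightarrow> ('u, 's) struct set" where
  "structures \<tau> = {M.
     (\<forall>s xs. xs \<in> rels M s \<longrightarrow> xs \<in> lists (univ M) \<and> \<tau> s = Some (Rel (length xs))) \<and>
     (\<forall>s xs. if xs \<in> lists (univ M) \<and> \<tau> s = Some (Fun (length xs))
              then funs M s xs \<in> univ M else funs M s xs = undefined)}"

text \<open>The values of \<open>f\<close> outside the universe of \<open>M\<close> are irrelevant.\<close>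

definition struct_iso ::
  "'s vocab \<Rightarrow> ('u \<Rightarrow> 'v) \<Rightarrow> ('u, 's) struct \<Rightarrow> ('v, 's) struct \<Rightarrow> bool" where
  "struct_iso \<tau> f M N \<longleftrightarrow>
     M \<in> structures \<tau> \<and> N \<in> structures \<tau> \<and> bij_betw f (univ M) (univ N) \<and>
     (\<forall>s. \<forall>xs\<in>lists (univ M).
        (\<tau> s = Some (Rel (length xs)) \<longrightarrow> (xs \<in> rels M s \<longleftrightarrow> map f xs \<in> rels N s)) \<and>
        (\<tau> s = Some (Fun (length xs)) \<longrightarrow> f (funs M s xs) = funs N s (map f xs)))"

definition restrict_struct :: "('u, 's) struct \<Rightarrow> 'u set \<Rightarrow> ('u, 's) struct" where
  "restrict_struct N X =
     \<lparr>univ = X,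
      rels = (\<lambda>s. rels N s \<inter> lists X),
      funs = (\<lambda>s xs. if xs \<in> lists X then funs N s xs else undefined)\<rparr>"

text \<open>Closure of the smaller universe under the functions is part of \<open>M \<in> structures \<tau>\<close>.\<close>

definition substructure :: "'s vocab \<Rightarrow> ('u, 's) struct \<Rightarrow> ('u, 's) struct \<Rightarrow> bool" where
  "substructure \<tau> M N \<longleftrightarrow>
     M \<in> structures \<tau> \<and> N \<in> structures \<tau> \<and>
     univ M \<subseteq> univ N \<and> M = restrict_struct N (univ M)"

text \<open>Union of an increasing chain; the choice of \<open>i\<close> does not matter in that case.\<close>

definition union_struct :: "'i set \<Rightarrow> ('i \<Rightarrow> ('u, 's) struct) \<Rightarrow> ('u, 's) struct" where
  "union_struct I M =
     \<lparr>univ = (\<Union>i\<in>I. univ (M i)),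
      rels = (\<lambda>s. \<Union>i\<in>I. rels (M i) s),
      funs = (\<lambda>s xs. if \<exists>i\<in>I. xs \<in> lists (univ (M i))
                     then funs (M (SOME i. i \<in> I \<and> xs \<in> lists (univ (M i)))) s xs
                     else undefined)\<rparr>"


section \<open>Abstract elementary classes\<close>

text \<open>A class of structures is a set of structures whose universes are subsets of an arbitrary
  type \<open>'u\<close>, which plays the role of the set-theoretic universe.\<close>

definition limit_order :: "'i rel \<Rightarrow> bool" where
  "limit_order r \<longleftrightarrow> Well_order r \<and> Field r \<noteq> {} \<and>
     (\<forall>i\<in>Field r. \<exists>j\<in>Field r. (i, j) \<in> r \<and> i \<noteq> j)"

definition iso_closed ::
  "'s vocab \<Rightarrow> ('u, 's) struct set \<Rightarrow> ('u, 's) struct rel \<Rightarrow> bool" where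
  "iso_closed \<tau> K le \<longleftrightarrow>
     (\<forall>M M' f. M \<in> K \<longrightarrow> struct_iso \<tau> f M M' \<longrightarrow> M' \<in> K) \<and>
     (\<forall>M N M' N' f. (M, N) \<in> le \<longrightarrow> struct_iso \<tau> f M M' \<longrightarrow> struct_iso \<tau> f N N' \<longrightarrow>
        (M', N') \<in> le)"

definition coherent ::
  "'s vocab \<Rightarrow> ('u, 's) struct set \<Rightarrow> ('u, 's) struct rel \<Rightarrow> bool" where
  "coherent \<tau> K le \<longleftrightarrow>
     (\<forall>M0\<in>K. \<forall>M1\<in>K. \<forall>M2\<in>K. substructure \<tau> M0 M1 \<longrightarrow> (M1, M2) \<in> le \<longrightarrow> (M0, M2) \<in> le \<longrightarrow>
        (M0, M1) \<in> le)"

text \<open>It is enough to index chains by well-orders on \<open>'u\<close> itself: each proper step of a chain adds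
  an element to the universe, so after omitting repetitions the length injects into \<open>'u\<close>, and the
  chain conditions are trivial for chains that are eventually constant.\<close>

definition chain_axioms :: "('u, 's) struct set \<Rightarrow> ('u, 's) struct rel \<Rightarrow> bool" where
  "chain_axioms K le \<longleftrightarrow>
     (\<forall>(r :: 'u rel) M.
        limit_order r \<longrightarrow> (\<forall>i\<in>Field r. M i \<in> K) \<longrightarrow> (\<forall>(i, j)\<in>r. (M i, M j) \<in> le) \<longrightarrow>
        union_struct (Field r) M \<in> K \<and>
        (\<forall>i\<in>Field r. (\<forall>j\<in>Field r. (i, j) \<in> r) \<longrightarrow> (M i, union_struct (Field r) M) \<in> le) \<and>
        (\<forall>N\<in>K. (\<forall>i\<in>Field r. (M i, N) \<in> le) \<longrightarrow> (union_struct (Field r) M, N) \<in> le))"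

definition LST_property ::
  "'s vocab \<Rightarrow> ('u, 's) struct set \<Rightarrow> ('u, 's) struct rel \<Rightarrow> 'k rel \<Rightarrow> bool" where
  "LST_property \<tau> K le l \<longleftrightarrow>
     Card_order l \<and> |dom \<tau>| \<le>o l \<and> natLeq \<le>o l \<and>
     (\<forall>N\<in>K. \<forall>A\<subseteq>univ N. \<exists>M\<in>K. A \<subseteq> univ M \<and> (M, N) \<in> le \<and> |univ M| \<le>o |A| +c l)"

text \<open>Only competitors on the same type need be considered, because every cardinal below \<open>l\<close> is
  represented there.\<close>

definition is_LS_number ::
  "'s vocab \<Rightarrow> ('u, 's) struct set \<Rightarrow> ('u, 's) struct rel \<Rightarrow> 'k rel \<Rightarrow> bool" where
  "is_LS_number \<tau> K le l \<longleftrightarrow>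
     LST_property \<tau> K le l \<and> (\<forall>l' :: 'k rel. LST_property \<tau> K le l' \<longrightarrow> l \<le>o l')"

text \<open>In the last clause the sum type is large enough to carry every cardinal that matters for
  structures over \<open>'u\<close> in a vocabulary over \<open>'s\<close>.\<close>

definition AEC :: "'s vocab \<Rightarrow> ('u, 's) struct set \<Rightarrow> ('u, 's) struct rel \<Rightarrow> bool" where
  "AEC \<tau> K le \<longleftrightarrow>
     K \<subseteq> structures \<tau> \<and>
     partial_order_on K le \<and>
     (\<forall>(M, N)\<in>le. substructure \<tau> M N) \<and>
     iso_closed \<tau> K le \<and>
     coherent \<tau> K le \<and>
     chain_axioms K le \<and>
     (\<exists>l :: ('u + 's + nat) rel. LST_property \<tau> K le l)"

definition cl :: "('u, 's) struct rel \<Rightarrow> ('u, 's) struct \<Rightarrow> 'u set \<Rightarrow> ('u, 's) struct" where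
  "cl le N A = restrict_struct N (\<Inter>{univ N0 |N0. (N0, N) \<in> le \<and> A \<subseteq> univ N0})"

definition has_intersections :: "('u, 's) struct set \<Rightarrow> ('u, 's) struct rel \<Rightarrow> bool" where
  "has_intersections K le \<longleftrightarrow> (\<forall>N\<in>K. \<forall>A\<subseteq>univ N. (cl le N A, N) \<in> le)"

definition models_of_card :: "('u, 's) struct set \<Rightarrow> 'k rel \<Rightarrow> ('u, 's) struct set" where
  "models_of_card K l = {M\<in>K. |univ M| =o l}"

definition iso_types :: "'s vocab \<Rightarrow> ('u, 's) struct set \<Rightarrow> ('u, 's) struct set set" where
  "iso_types \<tau> C = C // {(M, N). M \<in> C \<and> N \<in> C \<and> (\<exists>f. struct_iso \<tau> f M N)}"

text \<open>Pitfall: counting only the models of cardinality \<open>\<aleph>\<^sub>0\<close> says nothing about finite models. In a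
  countably infinite vocabulary there may be uncountably many of these: with unary predicates
  indexed by the natural numbers, an arbitrary set of subsets of the natural numbers is the same
  thing as an AEC (with equality as its order) of one-element structures, and it need not be
  analytic. Finite models are therefore to be counted as well.\<close>


section \<open>Functorial expansions\<close>

text \<open>The vocabulary \<open>\<tau>'\<close> extends \<open>\<tau>\<close> up to the embedding \<open>Inl\<close>: the old symbols are those of the
  form \<open>Inl s\<close>, the new ones those of the form \<open>Inr t\<close>.\<close>

definition reduct :: "('u, 's + 't) struct \<Rightarrow> ('u, 's) struct" where
  "reduct M = \<lparr>univ = univ M, rels = (\<lambda>s. rels M (Inl s)), funs = (\<lambda>s. funs M (Inl s))\<rparr>"

definition functorial_expansion ::
  "'s vocab \<Rightarrow> ('u, 's) struct set \<Rightarrow> ('u, 's) struct rel \<Rightarrow>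
   ('s + 't) vocab \<Rightarrow> ('u, 's + 't) struct set \<Rightarrow> bool" where
  "functorial_expansion \<tau> K le \<tau>' K' \<longleftrightarrow>
     (\<forall>s. \<tau>' (Inl s) = \<tau> s) \<and>
     K' \<subseteq> structures \<tau>' \<and>
     bij_betw reduct K' K \<and>
     (\<forall>M\<in>K'. \<forall>N\<in>K'. \<forall>f. struct_iso \<tau> f (reduct M) (reduct N) \<longrightarrow> struct_iso \<tau>' f M N) \<and>
     (\<forall>M\<in>K'. \<forall>N\<in>K'. (reduct M, reduct N) \<in> le \<longrightarrow> substructure \<tau>' M N)"

definition expansion_le ::
  "('u, 's) struct rel \<Rightarrow> ('u, 's + 't) struct set \<Rightarrow> ('u, 's + 't) struct rel" where
  "expansion_le le K' = {(M, N). M \<in> K' \<and> N \<in> K' \<and> (reduct M, reduct N) \<in> le}"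


section \<open>Borel and analytic presentations\<close>

text \<open>The space of structures with universe a subset of the natural numbers. The generators make
  this the Borel \<open>\<sigma>\<close>-algebra of the usual product topology; it is standard Borel when the
  vocabulary is countable.\<close>

definition code_space :: "'s vocab \<Rightarrow> (nat, 's) struct measure" where
  "code_space \<tau> = sigma (structures \<tau>)
     ({{C \<in> structures \<tau>. a \<in> univ C} |a. True} \<union>
      {{C \<in> structures \<tau>. xs \<in> rels C s} |s xs. True} \<union>
      {{C \<in> structures \<tau>. xs \<in> lists (univ C) \<and> funs C s xs = a} |s xs a. True})"

text \<open>A structure on a set of natural numbers codes a countable member of the class if it is
  isomorphic to one; for \<open>'u = nat\<close> and a class closed under isomorphism, the codes are just the
  members of the class. Likewise for pairs.\<close>

definition codes :: "'s vocab \<Rightarrow> ('u, 's) struct set \<Rightarrow> (nat, 's) struct set" where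
  "codes \<tau> K = {C. \<exists>M\<in>K. \<exists>f. struct_iso \<tau> f C M}"

definition codes_le :: "'s vocab \<Rightarrow> ('u, 's) struct rel \<Rightarrow> (nat, 's) struct rel" where
  "codes_le \<tau> le = {(C, D). univ C \<subseteq> univ D \<and>
     (\<exists>(M, N)\<in>le. \<exists>f. struct_iso \<tau> f C M \<and> struct_iso \<tau> f D N)}"

definition borel_presented ::
  "'s vocab \<Rightarrow> ('u, 's) struct set \<Rightarrow> ('u, 's) struct rel \<Rightarrow> bool" where
  "borel_presented \<tau> K le \<longleftrightarrow>
     AEC \<tau> K le \<and> is_LS_number \<tau> K le natLeq \<and>
     codes \<tau> K \<in> sets (code_space \<tau>) \<and>
     codes_le \<tau> le \<in> sets (code_space \<tau> \<Otimes>\<^sub>M code_space \<tau>)"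

text \<open>Analytic sets as projections of Borel sets along the Baire space.\<close>

definition analytic_in :: "'a measure \<Rightarrow> 'a set \<Rightarrow> bool" where
  "analytic_in S A \<longleftrightarrow> (\<exists>B \<in> sets (S \<Otimes>\<^sub>M (borel :: (nat \<Rightarrow> nat) measure)). A = fst ` B)"

definition analytically_presented ::
  "'s vocab \<Rightarrow> ('u, 's) struct set \<Rightarrow> ('u, 's) struct rel \<Rightarrow> bool" where
  "analytically_presented \<tau> K le \<longleftrightarrow>
     AEC \<tau> K le \<and> is_LS_number \<tau> K le natLeq \<and>
     analytic_in (code_space \<tau>) (codes \<tau> K) \<and>
     analytic_in (code_space \<tau> \<Otimes>\<^sub>M code_space \<tau>) (codes_le \<tau> le)"

end

theory Submission
  imports Defs "HOL-Library.Countable_Set_Type"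
begin

text \<open>Add a relation symbol for each isomorphism type of a pointed model \<open>(cl\<^sup>N(a), a)\<close>, where \<open>a\<close> is a
  finite tuple; by the assumption on countable models there are only countably many. The new relations
  of a countable structure \<open>C\<close> determine which elements belong to the closure of a tuple, and the
  closure of \<open>a\<close> is isomorphic to the model named by the type of \<open>a\<close> as soon as each type realised in
  that model over the distinguished tuple is realised in \<open>C\<close> over \<open>a\<close> (back and forth). This is a
  countable conjunction of countable disjunctions, so no Scott analysis is needed. A countable
  structure all of whose finitely generated closures are models is a model, as the union of an
  \<open>\<omega>\<close>-chain; for the same reason \<open>C \<le> D\<close> means that \<open>C\<close> is a substructure of \<open>D\<close> that contains
  the closures of its finite tuples. Guessing the new relations presents the original class
  analytically.\<close>

text \<open>A code is a structure on a set of natural numbers, while the class lives over a type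
  \<open>'u\<close> unrelated to \<open>nat\<close>, and no part of a code is known in advance to be
  a model. Closures in a code can therefore not be defined by intersecting submodels; they are read
  off from finite partial isomorphisms into expanded models. This is well defined because a type
  describes the whole closure of its tuple: a map between finite sets that preserves types extends
  to an isomorphism of closures. Finite sets are not closed under the functions, so partial
  isomorphisms compare functions through their graphs. The closures found inside a code come with
  unrelated isomorphisms onto models; to obtain an actual chain, the reduct of the code is copied
  into \<open>'u\<close> along a single injection. That there are only countably many types rests on
  two facts: a countable Loewenheim-Skolem number makes the closure of a finite tuple countable, and
  countable models, finite ones included, have countably many isomorphism types.\<close>

section \<open>Structures, restrictions and substructures\<close>

lemma structures_relD:
  "M \<in> structures \<tau> \<Longrightarrow> xs \<in> rels M s \<Longrightarrow> xs \<in> lists (univ M) \<and> \<tau> s = Some (Rel (length xs))"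
  unfolding structures_def by blast

lemma structures_funD:
  "M \<in> structures \<tau> \<Longrightarrow> xs \<in> lists (univ M) \<Longrightarrow> \<tau> s = Some (Fun (length xs)) \<Longrightarrow>
    funs M s xs \<in> univ M"
  unfolding structures_def by (simp split: if_splits)

lemma structures_fun_undefined:
  "M \<in> structures \<tau> \<Longrightarrow> \<not> (xs \<in> lists (univ M) \<and> \<tau> s = Some (Fun (length xs))) \<Longrightarrow>
    funs M s xs = undefined"
  unfolding structures_def by (simp split: if_splits)

lemma structures_eqI:
  fixes M N :: "('u, 's) struct"
  assumes M: "M \<in> structures \<tau>" and N: "N \<in> structures \<tau>" and univ: "univ M = univ N"
    and rels: "\<And>s xs. xs \<in> lists (univ M) \<Longrightarrow> \<tau> s = Some (Rel (length xs)) \<Longrightarrow>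
      xs \<in> rels M s \<longleftrightarrow> xs \<in> rels N s"
    and funs: "\<And>s xs. xs \<in> lists (univ M) \<Longrightarrow> \<tau> s = Some (Fun (length xs)) \<Longrightarrow>
      funs M s xs = funs N s xs"
  shows "M = N"
proof (rule struct.equality)
  show "rels M = rels N"
    using structures_relD[OF M] structures_relD[OF N] rels univ by (intro ext set_eqI) metis
  show "funs M = funs N"
    using structures_fun_undefined[OF M] structures_fun_undefined[OF N] funs univ
    by (intro ext) metis
qed (use univ in auto)

lemma univ_restrict [simp]: "univ (restrict_struct N X) = X"
  by (simp add: restrict_struct_def)

lemma rels_restrict: "xs \<in> lists X \<Longrightarrow> xs \<in> rels (restrict_struct N X) s \<longleftrightarrow> xs \<in> rels N s"
  by (simp add: restrict_struct_def)

lemma funs_restrict: "xs \<in> lists X \<Longrightarrow> funs (restrict_struct N X) s xs = funs N s xs"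
  by (simp add: restrict_struct_def)

lemma restrict_restrict: "X \<subseteq> Y \<Longrightarrow> restrict_struct (restrict_struct N Y) X = restrict_struct N X"
  by (rule struct.equality) (auto simp: restrict_struct_def fun_eq_iff dest: lists_mono[THEN subsetD])

lemma restrict_in_structures:
  assumes N: "N \<in> structures \<tau>" and X: "X \<subseteq> univ N"
    and closed: "\<And>s xs. xs \<in> lists X \<Longrightarrow> \<tau> s = Some (Fun (length xs)) \<Longrightarrow> funs N s xs \<in> X"
  shows "restrict_struct N X \<in> structures \<tau>"
proof -
  have "lists X \<subseteq> lists (univ N)" using X by (rule lists_mono)
  then show ?thesis
    using structures_relD[OF N] structures_fun_undefined[OF N] closed
    by (auto simp: structures_def restrict_struct_def)
qed

lemma restrict_univ: "N \<in> structures \<tau> \<Longrightarrow> restrict_struct N (univ N) = N"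
  by (rule structures_eqI[OF restrict_in_structures[where N = N]])
    (simp_all add: structures_funD rels_restrict funs_restrict)

lemma substructure_refl: "N \<in> structures \<tau> \<Longrightarrow> substructure \<tau> N N"
  by (simp add: substructure_def restrict_univ)

lemma substructure_restrict:
  "restrict_struct N X \<in> structures \<tau> \<Longrightarrow> N \<in> structures \<tau> \<Longrightarrow> X \<subseteq> univ N \<Longrightarrow>
    substructure \<tau> (restrict_struct N X) N"
  by (simp add: substructure_def)

lemma substructure_unique:
  "substructure \<tau> M N \<Longrightarrow> substructure \<tau> M' N \<Longrightarrow> univ M = univ M' \<Longrightarrow> M = M'"
  unfolding substructure_def by metis

lemma substructure_within:
  assumes "substructure \<tau> M0 N" "substructure \<tau> M1 N" "univ M0 \<subseteq> univ M1"
  shows "substructure \<tau> M0 M1"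
  using assms restrict_restrict unfolding substructure_def by metis

section \<open>Partial isomorphisms\<close>

lemma map_in_lists: "xs \<in> lists A \<Longrightarrow> f ` A \<subseteq> B \<Longrightarrow> map f xs \<in> lists B"
  by (auto simp: image_subset_iff)

text \<open>\<open>A\<close> is typically finite and not closed under the functions, so a function
  symbol is compared only through its graph on \<open>A\<close>: a value that leaves
  \<open>A\<close> merely has to leave the image of \<open>A\<close> as well. This form passes to
  subsets, compositions and inverses.\<close>

definition partial_iso ::
  "'s vocab \<Rightarrow> ('u \<Rightarrow> 'v) \<Rightarrow> 'u set \<Rightarrow> ('u, 's) struct \<Rightarrow> ('v, 's) struct \<Rightarrow> bool" where
  "partial_iso \<tau> f A M N \<longleftrightarrow>
     inj_on f A \<and> A \<subseteq> univ M \<and> f ` A \<subseteq> univ N \<and>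
     (\<forall>s. \<forall>xs\<in>lists A.
        (\<tau> s = Some (Rel (length xs)) \<longrightarrow> (xs \<in> rels M s \<longleftrightarrow> map f xs \<in> rels N s)) \<and>
        (\<tau> s = Some (Fun (length xs)) \<longrightarrow>
           (\<forall>y\<in>A. funs M s xs = y \<longleftrightarrow> funs N s (map f xs) = f y)))"

lemma partial_isoI:
  assumes "inj_on f A" "A \<subseteq> univ M" "f ` A \<subseteq> univ N"
    "\<And>s xs. xs \<in> lists A \<Longrightarrow> \<tau> s = Some (Rel (length xs)) \<Longrightarrow> xs \<in> rels M s \<longleftrightarrow> map f xs \<in> rels N s"
    "\<And>s xs y. xs \<in> lists A \<Longrightarrow> \<tau> s = Some (Fun (length xs)) \<Longrightarrow> y \<in> A \<Longrightarrow>
       funs M s xs = y \<longleftrightarrow> funs N s (map f xs) = f y"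
  shows "partial_iso \<tau> f A M N"
  using assms unfolding partial_iso_def by blast

lemma partial_isoD:
  assumes "partial_iso \<tau> f A M N"
  shows "inj_on f A" "A \<subseteq> univ M" "f ` A \<subseteq> univ N"
    "xs \<in> lists A \<Longrightarrow> \<tau> s = Some (Rel (length xs)) \<Longrightarrow> xs \<in> rels M s \<longleftrightarrow> map f xs \<in> rels N s"
    "xs \<in> lists A \<Longrightarrow> \<tau> s = Some (Fun (length xs)) \<Longrightarrow> y \<in> A \<Longrightarrow>
       funs M s xs = y \<longleftrightarrow> funs N s (map f xs) = f y"
  using assms unfolding partial_iso_def by blast+

lemma partial_iso_mono:
  assumes "partial_iso \<tau> f A M N" "B \<subseteq> A"
  shows "partial_iso \<tau> f B M N"
proof (rule partial_isoI)
  show "inj_on f B" "B \<subseteq> univ M" "f ` B \<subseteq> univ N"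
    using partial_isoD(1-3)[OF assms(1)] assms(2) inj_on_subset by blast+
qed (use partial_isoD(4,5)[OF assms(1)] lists_mono[OF assms(2)] assms(2) in blast)+

lemma partial_iso_cong:
  assumes "partial_iso \<tau> f A M N" "\<And>x. x \<in> A \<Longrightarrow> f x = g x"
  shows "partial_iso \<tau> g A M N"
proof -
  have m: "map g xs = map f xs" if "xs \<in> lists A" for xs
    using that assms(2) by auto
  have "inj_on g A" "g ` A = f ` A"
    using partial_isoD(1)[OF assms(1)] assms(2) by (auto simp: inj_on_def image_def)
  then show ?thesis
    using assms unfolding partial_iso_def by (simp add: m cong: ball_cong)
qed

lemma partial_iso_comp:
  assumes f: "partial_iso \<tau> f A M N" and g: "partial_iso \<tau> g (f ` A) N Q"
  shows "partial_iso \<tau> (g \<circ> f) A M Q"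
proof (rule partial_isoI)
  fix s xs y assume xs: "xs \<in> lists A"
  then have fxs: "map f xs \<in> lists (f ` A)" by (auto simp: lists_image)
  { assume "\<tau> s = Some (Rel (length xs))"
    then show "xs \<in> rels M s \<longleftrightarrow> map (g \<circ> f) xs \<in> rels Q s"
      using partial_isoD(4)[OF f xs] partial_isoD(4)[OF g fxs] by simp }
  { assume "\<tau> s = Some (Fun (length xs))" "y \<in> A"
    then show "funs M s xs = y \<longleftrightarrow> funs Q s (map (g \<circ> f) xs) = (g \<circ> f) y"
      using partial_isoD(5)[OF f xs] partial_isoD(5)[OF g fxs, of s "f y"] by simp }
qed (use partial_isoD(1-3)[OF f] partial_isoD(1-3)[OF g] in \<open>auto simp: comp_inj_on\<close>)

lemma partial_iso_inv:
  assumes f: "partial_iso \<tau> f A M N"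
  shows "partial_iso \<tau> (inv_into A f) (f ` A) N M"
proof (rule partial_isoI)
  note inj = partial_isoD(1)[OF f]
  show "inj_on (inv_into A f) (f ` A)" by (simp add: inj_on_inv_into)
  show "inv_into A f ` f ` A \<subseteq> univ M" using partial_isoD(2)[OF f] inj by simp
  fix s xs y assume xs: "xs \<in> lists (f ` A)"
  define ys where "ys = map (inv_into A f) xs"
  have ys: "ys \<in> lists A" using xs by (auto simp: ys_def inv_into_into)
  have "map f ys = map (\<lambda>x. x) xs"
    unfolding ys_def map_map by (rule map_cong) (use xs in \<open>auto simp: f_inv_into_f\<close>)
  then have *: "map f ys = xs" by simp
  then have l: "length ys = length xs" by (metis length_map)
  { assume "\<tau> s = Some (Rel (length xs))"
    then show "xs \<in> rels N s \<longleftrightarrow> map (inv_into A f) xs \<in> rels M s"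
      using partial_isoD(4)[OF f ys] * l by (simp add: ys_def[symmetric]) }
  { assume "\<tau> s = Some (Fun (length xs))" "y \<in> f ` A"
    then show "funs N s xs = y \<longleftrightarrow> funs M s (map (inv_into A f) xs) = inv_into A f y"
      using partial_isoD(5)[OF f ys, of s "inv_into A f y"] * l
      by (simp add: ys_def[symmetric] f_inv_into_f inv_into_into) }
qed (use partial_isoD[OF f] in auto)

text \<open>Each clause mentions finitely many elements: two for injectivity, a tuple for a
  relation, a tuple and a value for a function.\<close>

lemma partial_iso_finite_character:
  assumes A: "A \<subseteq> univ M" and fin: "\<And>B. finite B \<Longrightarrow> B \<subseteq> A \<Longrightarrow> partial_iso \<tau> f B M N"
  shows "partial_iso \<tau> f A M N"
proof (rule partial_isoI)
  show "inj_on f A"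
  proof (rule inj_onI)
    fix x y assume "x \<in> A" "y \<in> A" and eq: "f x = f y"
    then have "inj_on f {x, y}" by (intro partial_isoD(1)[OF fin]) auto
    then show "x = y" using eq by (rule inj_onD) auto
  qed
  show "f ` A \<subseteq> univ N"
  proof
    fix y assume "y \<in> f ` A"
    then obtain x where "x \<in> A" "y = f x" by auto
    then show "y \<in> univ N" using partial_isoD(3)[OF fin[of "{x}"]] by simp
  qed
  fix s xs y assume xs: "xs \<in> lists A"
  { assume "\<tau> s = Some (Rel (length xs))"
    then show "xs \<in> rels M s \<longleftrightarrow> map f xs \<in> rels N s"
      using xs by (intro partial_isoD(4)[OF fin[of "set xs"]]) auto }
  { assume "\<tau> s = Some (Fun (length xs))" "y \<in> A"
    then show "funs M s xs = y \<longleftrightarrow> funs N s (map f xs) = f y"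
      using xs by (intro partial_isoD(5)[OF fin[of "insert y (set xs)"]]) auto }
qed (rule A)

lemma partial_iso_sub_target:
  assumes "substructure \<tau> N0 N" "f ` A \<subseteq> univ N0"
  shows "partial_iso \<tau> f A M N0 \<longleftrightarrow> partial_iso \<tau> f A M N"
proof -
  have N0: "N0 = restrict_struct N (univ N0)" and sub: "univ N0 \<subseteq> univ N"
    using assms(1) by (auto simp: substructure_def)
  note * = map_in_lists[OF _ assms(2)]
  have r: "map f xs \<in> rels N0 s \<longleftrightarrow> map f xs \<in> rels N s" "funs N0 s (map f xs) = funs N s (map f xs)"
    if "xs \<in> lists A" for xs s
    using rels_restrict[OF *[OF that], of N s] funs_restrict[OF *[OF that], of N s]
    unfolding N0[symmetric] by simp_all
  show ?thesis
    using assms(2) sub unfolding partial_iso_def by (simp add: r cong: ball_cong) blast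
qed

lemma partial_iso_sub_source:
  assumes "substructure \<tau> M0 M" "A \<subseteq> univ M0"
  shows "partial_iso \<tau> f A M0 N \<longleftrightarrow> partial_iso \<tau> f A M N"
proof -
  have M0: "M0 = restrict_struct M (univ M0)" and sub: "univ M0 \<subseteq> univ M"
    using assms(1) by (auto simp: substructure_def)
  have *: "xs \<in> lists (univ M0)" if "xs \<in> lists A" for xs
    using that assms(2) by auto
  have r: "xs \<in> rels M0 s \<longleftrightarrow> xs \<in> rels M s" "funs M0 s xs = funs M s xs"
    if "xs \<in> lists A" for xs s
    using rels_restrict[OF *[OF that], of M s] funs_restrict[OF *[OF that], of M s]
    unfolding M0[symmetric] by simp_all
  show ?thesis
    using assms(2) sub unfolding partial_iso_def by (simp add: r cong: ball_cong) blast
qed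

lemma partial_iso_refl: "A \<subseteq> univ M \<Longrightarrow> partial_iso \<tau> (\<lambda>x. x) A M M"
  by (simp add: partial_iso_def)

text \<open>On the whole universe of \<open>M\<close> the graph condition is as strong as equality
  of the functions, because the value computed in \<open>M\<close> lies in that universe and can be
  taken as \<open>y\<close>.\<close>

lemma substructure_iff:
  "substructure \<tau> M N \<longleftrightarrow>
     M \<in> structures \<tau> \<and> N \<in> structures \<tau> \<and> partial_iso \<tau> (\<lambda>x. x) (univ M) M N"
proof (intro iffI)
  assume "substructure \<tau> M N"
  then show "M \<in> structures \<tau> \<and> N \<in> structures \<tau> \<and> partial_iso \<tau> (\<lambda>x. x) (univ M) M N"
    using partial_iso_refl[of "univ M" M \<tau>]
    by (simp add: partial_iso_sub_target[symmetric]) (simp add: substructure_def)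
next
  assume *: "M \<in> structures \<tau> \<and> N \<in> structures \<tau> \<and> partial_iso \<tau> (\<lambda>x. x) (univ M) M N"
  then have M: "M \<in> structures \<tau>" and N: "N \<in> structures \<tau>"
    and p: "partial_iso \<tau> (\<lambda>x. x) (univ M) M N" by auto
  have sub: "univ M \<subseteq> univ N" using partial_isoD(3)[OF p] by simp
  have f: "funs M s xs = funs N s xs"
    if "xs \<in> lists (univ M)" "\<tau> s = Some (Fun (length xs))" for s xs
    using partial_isoD(5)[OF p that structures_funD[OF M that]] by simp
  have "restrict_struct N (univ M) \<in> structures \<tau>"
    using restrict_in_structures[OF N sub] f structures_funD[OF M] by metis
  then have "M = restrict_struct N (univ M)"
    using partial_isoD(4)[OF p] f
    by (intro structures_eqI[OF M]) (simp_all add: rels_restrict funs_restrict)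
  then show "substructure \<tau> M N" using M N sub by (simp add: substructure_def)
qed

lemma struct_iso_iff:
  "struct_iso \<tau> f M N \<longleftrightarrow>
     M \<in> structures \<tau> \<and> N \<in> structures \<tau> \<and> partial_iso \<tau> f (univ M) M N \<and> f ` univ M = univ N"
proof (intro iffI)
  assume i: "struct_iso \<tau> f M N"
  then have "funs M s xs = y \<longleftrightarrow> funs N s (map f xs) = f y"
    if "xs \<in> lists (univ M)" "\<tau> s = Some (Fun (length xs))" "y \<in> univ M" for xs s y
    using that structures_funD[of M \<tau> xs s]
    by (metis (no_types, lifting) bij_betw_def inj_on_eq_iff struct_iso_def)
  then show "M \<in> structures \<tau> \<and> N \<in> structures \<tau> \<and> partial_iso \<tau> f (univ M) M N \<and> f ` univ M = univ N"
    using i by (auto simp: struct_iso_def partial_iso_def bij_betw_def)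
next
  assume "M \<in> structures \<tau> \<and> N \<in> structures \<tau> \<and> partial_iso \<tau> f (univ M) M N \<and> f ` univ M = univ N"
  then have M: "M \<in> structures \<tau>" and N: "N \<in> structures \<tau>" and p: "partial_iso \<tau> f (univ M) M N"
    and "f ` univ M = univ N" by auto
  moreover have "f (funs M s xs) = funs N s (map f xs)"
    if "xs \<in> lists (univ M)" "\<tau> s = Some (Fun (length xs))" for xs s
    using partial_isoD(5)[OF p that structures_funD[OF M that]] by simp
  ultimately show "struct_iso \<tau> f M N"
    using partial_isoD(1,4)[OF p] by (simp add: struct_iso_def bij_betw_def)
qed

lemma struct_isoD:
  assumes "struct_iso \<tau> f M N"
  shows "M \<in> structures \<tau>" "N \<in> structures \<tau>" "partial_iso \<tau> f (univ M) M N"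
    "f ` univ M = univ N" "bij_betw f (univ M) (univ N)"
  using assms struct_iso_iff[of \<tau> f M N] by (auto simp: struct_iso_def)

lemma struct_iso_cong:
  "struct_iso \<tau> f M N \<Longrightarrow> (\<And>x. x \<in> univ M \<Longrightarrow> f x = g x) \<Longrightarrow> struct_iso \<tau> g M N"
  using partial_iso_cong[of \<tau> f "univ M" M N g] by (auto simp: struct_iso_iff cong: image_cong)

lemma struct_iso_refl: "M \<in> structures \<tau> \<Longrightarrow> struct_iso \<tau> (\<lambda>x. x) M M"
  by (simp add: struct_iso_iff partial_iso_refl)

lemma struct_iso_sym: "struct_iso \<tau> f M N \<Longrightarrow> struct_iso \<tau> (inv_into (univ M) f) N M"
  using partial_iso_inv[of \<tau> f "univ M" M N] partial_isoD(1)[of \<tau> f "univ M" M N]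
    inv_into_image_cancel[of f "univ M" "univ M"]
  by (simp add: struct_iso_iff)

lemma struct_iso_trans:
  "struct_iso \<tau> f M N \<Longrightarrow> struct_iso \<tau> g N Q \<Longrightarrow> struct_iso \<tau> (g \<circ> f) M Q"
  using partial_iso_comp[of \<tau> f "univ M" M N g Q] unfolding struct_iso_iff
  by (metis image_comp)

text \<open>\<open>X\<close> is not assumed to be closed under the functions. As \<open>f\<close>
  maps onto the universe of \<open>N\<close>, the value in \<open>N\<close> has a preimage in
  \<open>X\<close>, and by the graph condition this preimage is the value in
  \<open>M\<close>.\<close>

lemma partial_iso_imp_struct_iso:
  assumes M: "M \<in> structures \<tau>" and N: "N \<in> structures \<tau>"
    and f: "partial_iso \<tau> f X M N" and onto: "f ` X = univ N"
  shows "struct_iso \<tau> f (restrict_struct M X) N"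
proof -
  have X: "X \<subseteq> univ M" using partial_isoD(2)[OF f] .
  have "funs M s xs \<in> X" if xs: "xs \<in> lists X" and s: "\<tau> s = Some (Fun (length xs))" for s xs
  proof -
    have "map f xs \<in> lists (univ N)" using xs onto by (simp add: map_in_lists)
    then have "funs N s (map f xs) \<in> f ` X"
      using structures_funD[OF N, of "map f xs" s] s onto by simp
    then obtain y where "y \<in> X" "funs N s (map f xs) = f y" by auto
    then show ?thesis using partial_isoD(5)[OF f xs s] by auto
  qed
  then have R: "restrict_struct M X \<in> structures \<tau>" by (rule restrict_in_structures[OF M X])
  moreover have "partial_iso \<tau> f X (restrict_struct M X) N"
    using f by (simp add: partial_iso_sub_source[OF substructure_restrict[OF R M X]])
  ultimately show ?thesis using N onto by (simp add: struct_iso_iff)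
qed

text \<open>Closure under the functions is known for \<open>X\<close> and not for its image. Hence
  \<open>partial_iso_imp_struct_iso\<close> is applied to the inverse of \<open>f\<close>, and the
  result is inverted again.\<close>

lemma struct_iso_restrict:
  assumes f: "struct_iso \<tau> f M N" and X: "X \<subseteq> univ M" and R: "restrict_struct M X \<in> structures \<tau>"
  shows "struct_iso \<tau> f (restrict_struct M X) (restrict_struct N (f ` X))"
proof -
  note f' = struct_isoD[OF f]
  have *: "f ` X \<subseteq> univ N" using f'(4) X by auto
  have p: "partial_iso \<tau> f X M N" using f'(3) X by (rule partial_iso_mono)
  have "partial_iso \<tau> (inv_into X f) (f ` X) N (restrict_struct M X)"
    using partial_iso_inv[OF p] partial_isoD(1)[OF p]
    by (simp add: partial_iso_sub_target[OF substructure_restrict[OF R f'(1) X]])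
  then have "struct_iso \<tau> (inv_into X f) (restrict_struct N (f ` X)) (restrict_struct M X)"
    by (rule partial_iso_imp_struct_iso[OF f'(2) R]) (use partial_isoD(1)[OF p] in simp)
  from struct_iso_sym[OF this] show ?thesis
  proof (rule struct_iso_cong)
    fix x assume "x \<in> univ (restrict_struct M X)"
    then show "inv_into (univ (restrict_struct N (f ` X))) (inv_into X f) x = f x"
      using partial_isoD(1)[OF p] inj_on_inv_into[of "f ` X" f X]
      by (simp add: inv_into_f_eq)
  qed
qed

section \<open>Chains\<close>

lemma substructure_agree:
  assumes "substructure \<tau> M N \<or> substructure \<tau> N M" "xs \<in> lists (univ M)" "xs \<in> lists (univ N)"
  shows "xs \<in> rels M s \<longleftrightarrow> xs \<in> rels N s" "funs M s xs = funs N s xs"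
  using assms rels_restrict[of xs "univ M" N s] rels_restrict[of xs "univ N" M s]
    funs_restrict[of xs "univ M" N s] funs_restrict[of xs "univ N" M s]
  unfolding substructure_def by metis+

text \<open>Whichever member the choice operator in \<open>union_struct\<close> picks, it agrees
  with \<open>U\<close>. The hypothesis \<open>dir\<close> puts each tuple of \<open>U\<close> into
  a single member, so that no relation or function value of \<open>U\<close> is missed.\<close>

lemma union_struct_eq:
  assumes U: "U \<in> structures \<tau>" and sub: "\<And>i. i \<in> I \<Longrightarrow> substructure \<tau> (M i) U"
    and dir: "\<And>xs. xs \<in> lists (univ U) \<Longrightarrow> \<exists>i\<in>I. xs \<in> lists (univ (M i))"
  shows "union_struct I M = U"
proof (rule struct.equality)
  have subl: "lists (univ (M i)) \<subseteq> lists (univ U)" if "i \<in> I" for i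
    using sub[OF that] by (simp add: lists_mono substructure_def)
  have Mi: "M i \<in> structures \<tau>" if "i \<in> I" for i
    using sub[OF that] by (simp add: substructure_def)
  show "univ (union_struct I M) = univ U"
  proof
    show "univ (union_struct I M) \<subseteq> univ U"
      using sub by (auto simp: union_struct_def substructure_def)
    show "univ U \<subseteq> univ (union_struct I M)"
    proof
      fix x assume "x \<in> univ U"
      then show "x \<in> univ (union_struct I M)" using dir[of "[x]"] by (simp add: union_struct_def)
    qed
  qed
  show "rels (union_struct I M) = rels U"
  proof (intro ext set_eqI iffI)
    fix s xs assume "xs \<in> rels (union_struct I M) s"
    then obtain i where i: "i \<in> I" "xs \<in> rels (M i) s" by (auto simp: union_struct_def)
    then have "xs \<in> lists (univ (M i))" using structures_relD[OF Mi] by blast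
    then show "xs \<in> rels U s" using i subl substructure_agree(1)[of \<tau> "M i" U] sub by blast
  next
    fix s xs assume xs: "xs \<in> rels U s"
    then have l: "xs \<in> lists (univ U)" using structures_relD[OF U] by blast
    then obtain i where i: "i \<in> I" "xs \<in> lists (univ (M i))" using dir by blast
    then have "xs \<in> rels (M i) s" using xs l substructure_agree(1)[of \<tau> "M i" U] sub by blast
    then show "xs \<in> rels (union_struct I M) s" using i by (auto simp: union_struct_def)
  qed
  show "funs (union_struct I M) = funs U"
  proof (intro ext)
    fix s xs
    show "funs (union_struct I M) s xs = funs U s xs"
    proof (cases "\<exists>i\<in>I. xs \<in> lists (univ (M i))")
      case True
      define i where "i = (SOME i. i \<in> I \<and> xs \<in> lists (univ (M i)))"
      have i: "i \<in> I \<and> xs \<in> lists (univ (M i))"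
        unfolding i_def by (rule someI_ex) (use True in blast)
      have "funs (union_struct I M) s xs = funs (M i) s xs"
        using True by (simp add: union_struct_def i_def)
      also have "\<dots> = funs U s xs"
        using i subl substructure_agree(2)[of \<tau> "M i" U] sub by blast
      finally show ?thesis .
    next
      case False
      then have "xs \<notin> lists (univ U)" using dir by blast
      then have "funs U s xs = undefined" using structures_fun_undefined[OF U] by blast
      then show ?thesis using False by (simp add: union_struct_def)
    qed
  qed
qed simp

lemma chain_lists:
  assumes ne: "I \<noteq> {}"
    and chain: "\<And>i j. i \<in> I \<Longrightarrow> j \<in> I \<Longrightarrow> V i \<subseteq> V j \<or> V j \<subseteq> V i"
    and xs: "xs \<in> lists (\<Union>i\<in>I. V i)"
  shows "\<exists>i\<in>I. xs \<in> lists (V i)"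
proof -
  have "\<Union> (V ` I) \<supseteq> set xs" using xs by auto
  moreover have "subset.chain (V ` I) (V ` I)"
    using chain unfolding subset_chain_def by blast
  ultimately obtain B where "B \<in> V ` I" "set xs \<subseteq> B"
    using finite_subset_Union_chain[of "set xs" "V ` I"] ne by blast
  then show ?thesis by (auto simp: in_lists_conv_set subset_iff)
qed

lemma substructure_union_struct:
  assumes U: "union_struct I M \<in> structures \<tau>" and i: "i \<in> I"
    and chain: "\<And>i j. i \<in> I \<Longrightarrow> j \<in> I \<Longrightarrow>
      substructure \<tau> (M i) (M j) \<or> substructure \<tau> (M j) (M i)"
  shows "substructure \<tau> (M i) (union_struct I M)"
proof -
  let ?U = "union_struct I M"
  have Mi: "M j \<in> structures \<tau>" if "j \<in> I" for j
    using chain[OF that that] by (simp add: substructure_def)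
  have sub: "univ (M i) \<subseteq> univ ?U" using i by (auto simp: union_struct_def)
  have r: "xs \<in> rels (M i) s \<longleftrightarrow> xs \<in> rels ?U s" if xs: "xs \<in> lists (univ (M i))" for xs s
  proof
    assume "xs \<in> rels ?U s"
    then obtain j where j: "j \<in> I" "xs \<in> rels (M j) s" by (auto simp: union_struct_def)
    then have "xs \<in> lists (univ (M j))" using structures_relD[OF Mi] by blast
    then show "xs \<in> rels (M i) s" using j xs substructure_agree(1)[OF chain[OF i j(1)]] by blast
  qed (use i in \<open>auto simp: union_struct_def\<close>)
  have f: "funs (M i) s xs = funs ?U s xs" if xs: "xs \<in> lists (univ (M i))" for xs s
  proof -
    define j where "j = (SOME i. i \<in> I \<and> xs \<in> lists (univ (M i)))"
    have j: "j \<in> I \<and> xs \<in> lists (univ (M j))"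
      unfolding j_def by (rule someI_ex) (use i xs in blast)
    have "\<exists>i\<in>I. xs \<in> lists (univ (M i))" using i xs by blast
    then have "funs ?U s xs = funs (M j) s xs"
      by (simp add: union_struct_def j_def)
    then show ?thesis using substructure_agree(2)[of \<tau> "M i" "M j"] chain[of i j] i j xs by metis
  qed
  have "partial_iso \<tau> (\<lambda>x. x) (univ (M i)) (M i) ?U"
    by (rule partial_isoI) (use sub r f in \<open>simp_all\<close>)
  then show ?thesis using U Mi i by (simp add: substructure_iff)
qed

section \<open>Elementary consequences of the axioms\<close>

locale abstract_elementary_class =
  fixes \<tau> :: "'s vocab" and K :: "('u, 's) struct set" and le :: "('u, 's) struct rel"
  assumes AEC: "AEC \<tau> K le"
begin

lemma le_in_K: "(M, N) \<in> le \<Longrightarrow> M \<in> K" "(M, N) \<in> le \<Longrightarrow> N \<in> K"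
  using AEC partial_order_onD(4)[of K le] unfolding AEC_def by blast+

lemma K_structures: "M \<in> K \<Longrightarrow> M \<in> structures \<tau>"
  using AEC unfolding AEC_def by blast

lemma le_refl: "M \<in> K \<Longrightarrow> (M, M) \<in> le"
  using AEC partial_order_onD(1)[of K le] unfolding AEC_def refl_on_def by blast

lemma le_trans: "(M, N) \<in> le \<Longrightarrow> (N, Q) \<in> le \<Longrightarrow> (M, Q) \<in> le"
  using AEC partial_order_onD(2)[of K le] unfolding AEC_def trans_def by blast

lemma le_antisym: "(M, N) \<in> le \<Longrightarrow> (N, M) \<in> le \<Longrightarrow> M = N"
  using AEC partial_order_onD(3)[of K le] unfolding AEC_def antisym_def by blast

lemma le_substructure: "(M, N) \<in> le \<Longrightarrow> substructure \<tau> M N"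
  using AEC unfolding AEC_def by blast

lemma le_univ: "(M, N) \<in> le \<Longrightarrow> univ M \<subseteq> univ N"
  using le_substructure unfolding substructure_def by blast

text \<open>This is coherence; its substructure hypothesis is automatic because both models sit
  inside \<open>N\<close>.\<close>

lemma le_within:
  assumes "(M0, N) \<in> le" "(M1, N) \<in> le" "univ M0 \<subseteq> univ M1"
  shows "(M0, M1) \<in> le"
proof -
  have "coherent \<tau> K le" using AEC unfolding AEC_def by blast
  moreover have "substructure \<tau> M0 M1" using assms substructure_within le_substructure by metis
  ultimately show ?thesis using assms(1,2) le_in_K unfolding coherent_def by blast
qed

lemma iso_in_K: "M \<in> K \<Longrightarrow> struct_iso \<tau> f M M' \<Longrightarrow> M' \<in> K"
  using AEC unfolding AEC_def iso_closed_def by blast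

lemma iso_le:
  "(M, N) \<in> le \<Longrightarrow> struct_iso \<tau> f M M' \<Longrightarrow> struct_iso \<tau> f N N' \<Longrightarrow> (M', N') \<in> le"
  using AEC unfolding AEC_def iso_closed_def by blast

lemma iso_restrict_le:
  assumes le: "(M, N) \<in> le" and f: "struct_iso \<tau> f N N'"
  shows "(restrict_struct N' (f ` univ M), N') \<in> le"
    and "struct_iso \<tau> f M (restrict_struct N' (f ` univ M))"
proof -
  have M: "restrict_struct N (univ M) = M" and s: "M \<in> structures \<tau>"
    using le_substructure[OF le] by (auto simp: substructure_def)
  show i: "struct_iso \<tau> f M (restrict_struct N' (f ` univ M))"
    using struct_iso_restrict[OF f le_univ[OF le]] M s by simp
  show "(restrict_struct N' (f ` univ M), N') \<in> le"
    using iso_le[OF le i f] .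
qed

lemma le_eq_restrict: "(M, N) \<in> le \<Longrightarrow> M = restrict_struct N (univ M)"
  using le_substructure by (simp add: substructure_def)

text \<open>The chain axiom only says that the first member lies below the union; for the other members,
  apply it to the tails of the chain.\<close>

lemma chain_union:
  fixes r :: "'u rel"
  assumes r: "limit_order r" and MK: "\<And>i. i \<in> Field r \<Longrightarrow> M i \<in> K"
    and chain: "\<And>i j. (i, j) \<in> r \<Longrightarrow> (M i, M j) \<in> le"
  shows "union_struct (Field r) M \<in> K"
    and "i \<in> Field r \<Longrightarrow> (M i, union_struct (Field r) M) \<in> le"
    and "(\<And>i. i \<in> Field r \<Longrightarrow> (M i, N) \<in> le) \<Longrightarrow> (union_struct (Field r) M, N) \<in> le"
proof -
  have ca: "chain_axioms K le" using AEC unfolding AEC_def by blast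
  let ?U = "union_struct (Field r) M"
  have all: "\<forall>i\<in>Field r. M i \<in> K" "\<forall>(i, j)\<in>r. (M i, M j) \<in> le" using MK chain by auto
  show UK: "?U \<in> K" using ca r all unfolding chain_axioms_def by blast
  have WO: "Well_order r" and ne: "Field r \<noteq> {}"
    and lim: "\<And>i. i \<in> Field r \<Longrightarrow> \<exists>j\<in>Field r. (i, j) \<in> r \<and> i \<noteq> j"
    using r unfolding limit_order_def by auto
  then have lin: "linear_order_on (Field r) r" by (simp add: well_order_on_def)
  then have tr: "trans r" and rf: "refl_on (Field r) r" and tot: "total_on (Field r) r"
    unfolding linear_order_on_def partial_order_on_def preorder_on_def by auto
  have cmp: "(i, j) \<in> r \<or> (j, i) \<in> r" if "i \<in> Field r" "j \<in> Field r" for i j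
    using that rf tot unfolding refl_on_def total_on_def by metis
  have subM: "substructure \<tau> (M i) (M j) \<or> substructure \<tau> (M j) (M i)"
    if "i \<in> Field r" "j \<in> Field r" for i j
    using cmp[OF that] chain le_substructure by blast
  { assume N: "\<And>i. i \<in> Field r \<Longrightarrow> (M i, N) \<in> le"
    then have "N \<in> K" using ne le_in_K by blast
    then show "(?U, N) \<in> le" using ca r all N unfolding chain_axioms_def by blast }
  assume i: "i \<in> Field r"
  define r' where "r' = Restr r {a. (i, a) \<in> r}"
  have F: "Field r' = {a. (i, a) \<in> r}"
    using rf unfolding r'_def Field_def refl_on_def by blast
  have ii: "(i, i) \<in> r" using rf i by (simp add: refl_on_def)
  have sub: "Field r' \<subseteq> Field r" using F by (auto simp: Field_def)
  have "limit_order r'"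
    unfolding limit_order_def
  proof (intro conjI ballI)
    show "Well_order r'" unfolding r'_def by (rule Well_order_Restr[OF WO])
    show "Field r' \<noteq> {}" using F ii by blast
    fix a assume "a \<in> Field r'"
    then have a: "(i, a) \<in> r" using F by blast
    then have "a \<in> Field r" by (auto simp: Field_def)
    then obtain b where b: "(a, b) \<in> r" "a \<noteq> b" using lim by blast
    then have "(i, b) \<in> r" using a tr by (meson transD)
    then show "\<exists>b\<in>Field r'. (a, b) \<in> r' \<and> a \<noteq> b" using a b F by (auto simp: r'_def)
  qed
  moreover have "\<forall>i\<in>Field r'. M i \<in> K" "\<forall>(i, j)\<in>r'. (M i, M j) \<in> le"
    using all sub by (auto simp: r'_def)
  moreover have "i \<in> Field r'" "\<forall>j\<in>Field r'. (i, j) \<in> r'" using F ii by (auto simp: r'_def)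
  ultimately have *: "(M i, union_struct (Field r') M) \<in> le"
    using ca unfolding chain_axioms_def by blast
  have "union_struct (Field r') M = ?U"
  proof (rule union_struct_eq[OF K_structures[OF UK]])
    fix j assume "j \<in> Field r'"
    then show "substructure \<tau> (M j) ?U"
      using substructure_union_struct[OF K_structures[OF UK]] sub subM by blast
  next
    fix xs assume "xs \<in> lists (univ ?U)"
    then have xs: "xs \<in> lists (\<Union>j\<in>Field r. univ (M j))" by (simp add: union_struct_def)
    have "\<exists>j\<in>Field r. xs \<in> lists (univ (M j))"
      by (rule chain_lists[OF ne _ xs]) (use subM in \<open>auto simp: substructure_def\<close>)
    then obtain j where j: "j \<in> Field r" "xs \<in> lists (univ (M j))" by blast
    show "\<exists>j\<in>Field r'. xs \<in> lists (univ (M j))"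
    proof (cases "(i, j) \<in> r")
      case True then show ?thesis using j F by blast
    next
      case False
      \<comment> \<open>Members before \<open>i\<close> are contained in \<open>M i\<close>, so the
        tail has the same union as the whole chain.\<close>
      then have "univ (M j) \<subseteq> univ (M i)" using cmp[OF i j(1)] le_univ chain by blast
      then show ?thesis using j lists_mono[of "univ (M j)" "univ (M i)"] F ii by blast
    qed
  qed
  then show "(M i, ?U) \<in> le" using * by simp
qed

text \<open>The chain axiom is indexed by well-orders on \<open>'u\<close>; an injection of
  \<open>nat\<close> into \<open>'u\<close> supplies a copy of \<omega>, which is why
  \<open>'u\<close> is assumed infinite. The union enters as a given structure \<open>U\<close>, so
  that a structure already at hand can be recognised as the union.\<close>

lemma omega_union:
  fixes M :: "nat \<Rightarrow> ('u, 's) struct"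
  assumes inf: "infinite (UNIV :: 'u set)"
    and step: "\<And>n. (M n, M (Suc n)) \<in> le"
    and U: "U \<in> structures \<tau>" and sub: "\<And>n. substructure \<tau> (M n) U"
    and un: "univ U = (\<Union>n. univ (M n))"
  shows "U \<in> K" and "(M n, U) \<in> le"
    and "(\<And>n. (M n, N) \<in> le) \<Longrightarrow> (U, N) \<in> le"
proof -
  obtain h :: "nat \<Rightarrow> 'u" where h: "inj h" using infinite_countable_subset[OF inf] by blast
  define r where "r = dir_image natLeq h"
  have r_iff: "(a, b) \<in> r \<longleftrightarrow> (\<exists>m n. a = h m \<and> b = h n \<and> m \<le> n)" for a b
    by (auto simp: r_def dir_image_def natLeq_def)
  have F: "Field r = range h" by (simp add: r_def dir_image_Field Field_natLeq)
  define M' where "M' = M \<circ> inv h"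
  have M'h: "M' (h n) = M n" for n using h by (simp add: M'_def)
  have mono: "(M m, M n) \<in> le" if "m \<le> n" for m n
    using that
  proof (induction rule: dec_induct)
    case base show ?case using step le_in_K le_refl by blast
  next
    case (step n) then show ?case using assms(2) le_trans by blast
  qed
  have lim: "limit_order r"
    unfolding limit_order_def
  proof (intro conjI ballI)
    show "Well_order r" unfolding r_def
      by (rule Well_order_dir_image[OF natLeq_Well_order]) (use h in \<open>simp add: Field_natLeq\<close>)
    show "Field r \<noteq> {}" using F by simp
    fix a assume "a \<in> Field r"
    then obtain n where "a = h n" using F by auto
    then show "\<exists>b\<in>Field r. (a, b) \<in> r \<and> a \<noteq> b"
      using F h by (intro bexI[of _ "h (Suc n)"]) (auto simp: r_iff inj_eq)
  qed
  have MK: "M' i \<in> K" if "i \<in> Field r" for i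
    using that F M'h step le_in_K by fastforce
  have chain: "(M' i, M' j) \<in> le" if "(i, j) \<in> r" for i j
    using that mono M'h r_iff by auto
  have UU: "union_struct (Field r) M' = U"
  proof (rule union_struct_eq[OF U])
    fix i assume "i \<in> Field r"
    then show "substructure \<tau> (M' i) U" using F M'h sub by auto
  next
    fix xs assume "xs \<in> lists (univ U)"
    then have xs: "xs \<in> lists (\<Union>n\<in>UNIV. univ (M n))" using un by simp
    have "\<exists>n\<in>UNIV. xs \<in> lists (univ (M n))"
      by (rule chain_lists[OF _ _ xs]) (use mono le_univ nat_le_linear in blast)+
    then show "\<exists>i\<in>Field r. xs \<in> lists (univ (M' i))" using F M'h by auto
  qed
  show "U \<in> K" using chain_union(1)[where M = M', OF lim MK chain] UU by simp
  have "(M' (h n), U) \<in> le"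
    using chain_union(2)[where M = M', OF lim MK chain, where i = "h n"] UU F by simp
  then show "(M n, U) \<in> le" by (simp add: M'h)
  assume N: "\<And>n. (M n, N) \<in> le"
  then have "(M' i, N) \<in> le" if "i \<in> Field r" for i
    using that F M'h by auto
  then show "(U, N) \<in> le"
    using chain_union(3)[where M = M', OF lim MK chain, where N = N] UU by blast
qed

end

section \<open>Functorial expansions of abstract elementary classes\<close>

text \<open>The inverse of \<open>f\<close> followed by \<open>f\<close> makes the identity an
  isomorphism from \<open>N\<close> to \<open>N'\<close>. This identifies an isomorphic copy of an
  expansion with the expansion of its reduct.\<close>

lemma struct_iso_unique:
  assumes f: "struct_iso \<tau> f M N" and g: "struct_iso \<tau> f M N'"
  shows "N = N'"
proof -
  have un: "univ N = univ N'" using struct_isoD(4)[OF f] struct_isoD(4)[OF g] by simp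
  have "struct_iso \<tau> (\<lambda>x. x) N N'"
    by (rule struct_iso_cong[OF struct_iso_trans[OF struct_iso_sym[OF f] g]])
      (simp add: struct_isoD(4)[OF f, symmetric] f_inv_into_f)
  then have "substructure \<tau> N N'" unfolding struct_iso_iff substructure_iff by blast
  then show ?thesis using un substructure_refl substructure_unique struct_isoD(2)[OF g] by metis
qed

lemma univ_reduct [simp]: "univ (reduct M) = univ M"
  by (simp add: reduct_def)

lemma reduct_in_structures:
  assumes "M \<in> structures \<tau>'" "\<And>s. \<tau>' (Inl s) = \<tau> s"
  shows "reduct M \<in> structures \<tau>"
  using assms(1) unfolding structures_def by (simp add: reduct_def assms(2)[symmetric])

lemma partial_iso_reduct:
  assumes "partial_iso \<tau>' f A M N" "\<And>s. \<tau>' (Inl s) = \<tau> s"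
  shows "partial_iso \<tau> f A (reduct M) (reduct N)"
  using assms(1) unfolding partial_iso_def by (simp add: reduct_def assms(2)[symmetric])

lemma struct_iso_reduct:
  assumes "struct_iso \<tau>' f M N" "\<And>s. \<tau>' (Inl s) = \<tau> s"
  shows "struct_iso \<tau> f (reduct M) (reduct N)"
  using assms(1) unfolding struct_iso_iff
  by (simp add: reduct_in_structures[of _ \<tau>' \<tau>, OF _ assms(2)]
      partial_iso_reduct[of \<tau>' _ _ _ _ \<tau>, OF _ assms(2)])

lemma LST_property_ordIso:
  assumes "LST_property \<tau> K le l" "(l, l') \<in> ordIso" "Card_order l'"
  shows "LST_property \<tau> K le l'"
proof -
  have ll: "l \<le>o l'" using assms(2) by (rule ordIso_imp_ordLeq)
  have "|A| +c l \<le>o |A| +c l'" for A :: "'b set" using ll by (rule csum_mono2)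
  then show ?thesis
    using assms(1,3) ll unfolding LST_property_def by (meson ordLeq_transitive)
qed

context abstract_elementary_class
begin

text \<open>The order axioms, coherence and the Loewenheim-Skolem axiom concern reducts only.
  Closure under isomorphisms and under chains uses functoriality: the structure in question has to
  be the very expansion that its reduct has in \<open>K'\<close>.\<close>

lemma expansion_AEC:
  fixes \<tau>' :: "('s + 't) vocab"
  assumes FE: "functorial_expansion \<tau> K le \<tau>' K'"
    and LST: "LST_property \<tau> K le (natLeq :: nat rel)" and dom: "|dom \<tau>'| \<le>o natLeq"
  shows "AEC \<tau>' K' (expansion_le le K')"
    and "LST_property \<tau>' K' (expansion_le le K') (natLeq :: nat rel)"
proof -
  let ?le = "expansion_le le K'"
  have Inl: "\<And>s. \<tau>' (Inl s) = \<tau> s" and K': "K' \<subseteq> structures \<tau>'" and inj: "inj_on reduct K'"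
    and im: "reduct ` K' = K"
    and iso: "\<And>M N f. M \<in> K' \<Longrightarrow> N \<in> K' \<Longrightarrow> struct_iso \<tau> f (reduct M) (reduct N) \<Longrightarrow> struct_iso \<tau>' f M N"
    and sub: "\<And>M N. (M, N) \<in> ?le \<Longrightarrow> substructure \<tau>' M N"
    using FE unfolding functorial_expansion_def bij_betw_def expansion_le_def by auto
  have redK: "reduct M \<in> K" if "M \<in> K'" for M using that im by blast
  have le_iff: "(M, N) \<in> ?le \<longleftrightarrow> M \<in> K' \<and> N \<in> K' \<and> (reduct M, reduct N) \<in> le" for M N
    by (simp add: expansion_le_def)
  have iso_closed1: "M' \<in> K'" if M: "M \<in> K'" and f: "struct_iso \<tau>' f M M'" for M M' f
  proof -
    have f': "struct_iso \<tau> f (reduct M) (reduct M')" by (rule struct_iso_reduct[OF f Inl])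
    then have "reduct M' \<in> K" using iso_in_K redK M by blast
    then obtain M'' where M'': "M'' \<in> K'" "reduct M'' = reduct M'" using im by (metis imageE)
    \<comment> \<open>\<open>f\<close> is an isomorphism of \<open>M\<close> onto \<open>M'\<close>
      and onto the expansion of the reduct of \<open>M'\<close>, and it determines its
      target.\<close>
    then have "struct_iso \<tau>' f M M''" using iso[OF M] f' by simp
    then show ?thesis using struct_iso_unique[OF f] M'' by blast
  qed
  have chain: "union_struct (Field r) M \<in> K' \<and>
      (\<forall>i\<in>Field r. (\<forall>j\<in>Field r. (i, j) \<in> r) \<longrightarrow> (M i, union_struct (Field r) M) \<in> ?le) \<and>
      (\<forall>N\<in>K'. (\<forall>i\<in>Field r. (M i, N) \<in> ?le) \<longrightarrow> (union_struct (Field r) M, N) \<in> ?le)"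
    if r: "limit_order r" and MK: "\<forall>i\<in>Field r. M i \<in> K'" and ch: "\<forall>(i, j)\<in>r. (M i, M j) \<in> ?le"
    for r :: "'u rel" and M
  proof -
    define m where "m i = reduct (M i)" for i
    have mK: "m i \<in> K" if "i \<in> Field r" for i using that MK redK m_def by simp
    have mle: "(m i, m j) \<in> le" if "(i, j) \<in> r" for i j
      using that ch le_iff m_def by auto
    define u where "u = union_struct (Field r) m"
    have uK: "u \<in> K" and u_ub: "\<And>i. i \<in> Field r \<Longrightarrow> (m i, u) \<in> le"
      and u_least: "\<And>n. (\<And>i. i \<in> Field r \<Longrightarrow> (m i, n) \<in> le) \<Longrightarrow> (u, n) \<in> le"
      unfolding u_def using chain_union[where M = m, OF r] mK mle by blast+
    \<comment> \<open>\<open>W\<close> is the expansion of the union of the reducts. By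
      functoriality each \<open>M i\<close> is a substructure of \<open>W\<close>, so the union of
      the expansions can only be \<open>W\<close>.\<close>
    obtain W where W: "W \<in> K'" "reduct W = u" using uK im by (metis imageE)
    have Wle: "(M i, W) \<in> ?le" if "i \<in> Field r" for i
      using u_ub[OF that] MK W that le_iff m_def by auto
    have ne: "Field r \<noteq> {}" and WO: "Well_order r" using r by (auto simp: limit_order_def)
    have "union_struct (Field r) M = W"
    proof (rule union_struct_eq)
      show "W \<in> structures \<tau>'" using W K' by blast
      show "substructure \<tau>' (M i) W" if "i \<in> Field r" for i using Wle[OF that] sub by blast
      fix xs assume xs: "xs \<in> lists (univ W)"
      have "univ W = univ u" using W by auto
      also have "\<dots> = (\<Union>i\<in>Field r. univ (M i))" by (simp add: u_def union_struct_def m_def)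
      finally have xs': "xs \<in> lists (\<Union>i\<in>Field r. univ (M i))" using xs by simp
      show "\<exists>i\<in>Field r. xs \<in> lists (univ (M i))"
      proof (rule chain_lists[OF ne _ xs'])
        fix i j assume ij: "i \<in> Field r" "j \<in> Field r"
        then have "(i, j) \<in> r \<or> (j, i) \<in> r"
          using WO unfolding well_order_on_def linear_order_on_def partial_order_on_def
            preorder_on_def refl_on_def total_on_def by metis
        then have "(m i, m j) \<in> le \<or> (m j, m i) \<in> le" using mle by blast
        then show "univ (M i) \<subseteq> univ (M j) \<or> univ (M j) \<subseteq> univ (M i)"
          using le_univ[of "m i" "m j"] le_univ[of "m j" "m i"] by (auto simp: m_def)
      qed
    qed
    moreover have "(W, N) \<in> ?le" if "N \<in> K'" "\<forall>i\<in>Field r. (M i, N) \<in> ?le" for N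
      using u_least[of "reduct N"] that W le_iff m_def by simp
    ultimately show ?thesis using W Wle by simp
  qed
  show LST': "LST_property \<tau>' K' ?le (natLeq :: nat rel)"
    unfolding LST_property_def
  proof (intro conjI ballI allI impI)
    fix N A assume N: "N \<in> K'" and A: "A \<subseteq> univ N"
    then have "A \<subseteq> univ (reduct N)" by simp
    then obtain m where m: "m \<in> K" "A \<subseteq> univ m" "(m, reduct N) \<in> le" "|univ m| \<le>o |A| +c (natLeq :: nat rel)"
      using LST redK[OF N] unfolding LST_property_def by blast
    then obtain M where "M \<in> K'" "reduct M = m" using im by (metis imageE)
    then show "\<exists>M\<in>K'. A \<subseteq> univ M \<and> (M, N) \<in> ?le \<and> |univ M| \<le>o |A| +c (natLeq :: nat rel)"
      using m N le_iff by (intro bexI[of _ M]) auto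
  qed (use LST dom in \<open>auto simp: LST_property_def\<close>)
  show "AEC \<tau>' K' ?le"
    unfolding AEC_def
  proof (intro conjI)
    show "partial_order_on K' ?le"
      unfolding partial_order_on_def preorder_on_def
    proof (intro conjI)
      show "?le \<subseteq> K' \<times> K'" by (auto simp: expansion_le_def)
      show "refl_on K' ?le" using redK le_refl by (auto simp: refl_on_def le_iff)
      show "trans ?le" unfolding trans_def le_iff using le_trans by blast
      show "antisym ?le" unfolding antisym_def le_iff using le_antisym inj by (meson inj_onD)
    qed
    show "iso_closed \<tau>' K' ?le"
      unfolding iso_closed_def
    proof (intro conjI allI impI)
      fix M N M' N' :: "('u, 's + 't) struct" and f :: "'u \<Rightarrow> 'u"
      assume *: "(M, N) \<in> ?le" "struct_iso \<tau>' f M M'" "struct_iso \<tau>' f N N'"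
      then have "(reduct M', reduct N') \<in> le"
        using iso_le[OF _ struct_iso_reduct[OF *(2) Inl] struct_iso_reduct[OF *(3) Inl]] le_iff
        by blast
      then show "(M', N') \<in> ?le" using * iso_closed1 le_iff by blast
    qed (rule iso_closed1)
    show "coherent \<tau>' K' ?le"
      unfolding coherent_def le_iff
    proof (intro ballI impI)
      fix M0 M1 M2 assume *: "M0 \<in> K'" "M1 \<in> K'" "substructure \<tau>' M0 M1"
        "M1 \<in> K' \<and> M2 \<in> K' \<and> (reduct M1, reduct M2) \<in> le"
        "M0 \<in> K' \<and> M2 \<in> K' \<and> (reduct M0, reduct M2) \<in> le"
      then have "univ (reduct M0) \<subseteq> univ (reduct M1)" by (simp add: substructure_def)
      then show "M0 \<in> K' \<and> M1 \<in> K' \<and> (reduct M0, reduct M1) \<in> le"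
        using * le_within by blast
    qed
    show "chain_axioms K' ?le"
      unfolding chain_axioms_def using chain by blast
    \<comment> \<open>\<open>AEC\<close> asks for a cardinal on the sum type, so
      \<open>natLeq\<close> is copied into the last summand.\<close>
    define l where "l = |range (Inr \<circ> Inr :: nat \<Rightarrow> 'u + ('s + 't) + nat)|"
    have "inj (Inr \<circ> Inr :: nat \<Rightarrow> 'u + ('s + 't) + nat)" by (simp add: inj_on_def)
    then have "(card_of (UNIV :: nat set), l) \<in> ordIso"
      unfolding l_def by (intro card_of_ordIsoI) (rule inj_on_imp_bij_betw)
    then have "(natLeq, l) \<in> ordIso"
      using card_of_nat ordIso_symmetric ordIso_transitive by blast
    then show "\<exists>l :: ('u + ('s + 't) + nat) rel. LST_property \<tau>' K' ?le l"
      using LST_property_ordIso[OF LST' _ card_of_Card_order] unfolding l_def by blast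
  qed (use K' sub in auto)
qed

end

text \<open>\<open>LST_property\<close> already contains \<open>natLeq \<le>o l\<close>, so
  minimality is automatic.\<close>

lemma is_LS_number_natLeq:
  "is_LS_number \<tau> K le (natLeq :: nat rel) \<longleftrightarrow> LST_property \<tau> K le (natLeq :: nat rel)"
  by (auto simp: is_LS_number_def LST_property_def)

section \<open>Closures\<close>

lemma univ_cl: "univ (cl le N A) = \<Inter>{univ N0 |N0. (N0, N) \<in> le \<and> A \<subseteq> univ N0}"
  by (simp add: cl_def)

lemma cl_extensive: "A \<subseteq> univ (cl le N A)"
  unfolding univ_cl by blast

lemma cl_least: "(M, N) \<in> le \<Longrightarrow> A \<subseteq> univ M \<Longrightarrow> univ (cl le N A) \<subseteq> univ M"
  unfolding univ_cl by blast

lemma cl_mono: "A \<subseteq> B \<Longrightarrow> univ (cl le N A) \<subseteq> univ (cl le N B)"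
  unfolding univ_cl by blast

locale aec_with_intersections = abstract_elementary_class \<tau> K le
  for \<tau> :: "'s vocab" and K :: "('u, 's) struct set" and le :: "('u, 's) struct rel" +
  assumes has_intersections: "has_intersections K le"
    and LST: "LST_property \<tau> K le (natLeq :: nat rel)"
begin

lemma cl_le: "N \<in> K \<Longrightarrow> A \<subseteq> univ N \<Longrightarrow> (cl le N A, N) \<in> le"
  using has_intersections unfolding has_intersections_def by blast

lemma cl_in_K: "N \<in> K \<Longrightarrow> A \<subseteq> univ N \<Longrightarrow> cl le N A \<in> K"
  using cl_le le_in_K by blast

text \<open>The closure in \<open>N\<close> lies inside \<open>M\<close> by minimality and is strong
  in \<open>M\<close> by coherence; the closure in \<open>M\<close> is strong in \<open>N\<close> by
  transitivity. So each takes part in the intersection that defines the other.\<close>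

lemma cl_sub:
  assumes MN: "(M, N) \<in> le" and A: "A \<subseteq> univ M"
  shows "cl le M A = cl le N A"
proof -
  have M: "M \<in> K" "N \<in> K" and AN: "A \<subseteq> univ N" using le_in_K MN le_univ A by blast+
  have "(cl le N A, M) \<in> le"
    by (rule le_within[OF cl_le[OF M(2) AN] MN cl_least[OF MN A]])
  then have "univ (cl le M A) \<subseteq> univ (cl le N A)" using cl_extensive by (rule cl_least)
  moreover have "univ (cl le N A) \<subseteq> univ (cl le M A)"
    using le_trans[OF cl_le[OF M(1) A] MN] cl_extensive by (rule cl_least)
  ultimately have "univ (cl le M A) = univ (cl le N A)" by blast
  then show ?thesis
    using substructure_unique le_substructure le_trans[OF cl_le[OF M(1) A] MN] cl_le[OF M(2) AN]
    by blast
qed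

lemma cl_idem: "N \<in> K \<Longrightarrow> A \<subseteq> univ N \<Longrightarrow> cl le (cl le N A) A = cl le N A"
  by (rule cl_sub[OF cl_le cl_extensive])

text \<open>By invariance the image of the closure is a strong submodel of \<open>N\<close>, hence
  one of the sets that are intersected. The reverse inclusion comes from the inverse
  isomorphism.\<close>

lemma univ_cl_iso_subset:
  assumes f: "struct_iso \<tau> f M N" and M: "M \<in> K" and A: "A \<subseteq> univ M"
  shows "univ (cl le N (f ` A)) \<subseteq> f ` univ (cl le M A)"
proof -
  have "(restrict_struct N (f ` univ (cl le M A)), N) \<in> le"
    by (rule iso_restrict_le(1)[OF cl_le[OF M A] f])
  then have "univ (cl le N (f ` A)) \<subseteq> univ (restrict_struct N (f ` univ (cl le M A)))"
    by (rule cl_least) (simp add: image_mono cl_extensive)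
  then show ?thesis by simp
qed

lemma univ_cl_iso:
  assumes f: "struct_iso \<tau> f M N" and M: "M \<in> K" and A: "A \<subseteq> univ M"
  shows "univ (cl le N (f ` A)) = f ` univ (cl le M A)"
proof
  let ?g = "inv_into (univ M) f"
  have N: "N \<in> K" using iso_in_K[OF M f] .
  have inj: "inj_on f (univ M)" using struct_isoD(5)[OF f] by (simp add: bij_betw_def)
  have fA: "f ` A \<subseteq> univ N" using struct_isoD(4)[OF f] A by blast
  have "?g ` f ` A = A" using inj A by simp
  then have "univ (cl le M A) \<subseteq> ?g ` univ (cl le N (f ` A))"
    using univ_cl_iso_subset[OF struct_iso_sym[OF f] N fA] by simp
  then have "f ` univ (cl le M A) \<subseteq> f ` ?g ` univ (cl le N (f ` A))" by (rule image_mono)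
  also have "\<dots> = univ (cl le N (f ` A))"
    using image_inv_into_cancel[OF struct_isoD(4)[OF f]] le_univ[OF cl_le[OF N fA]] by blast
  finally show "f ` univ (cl le M A) \<subseteq> univ (cl le N (f ` A))" .
qed (rule univ_cl_iso_subset[OF assms])

lemma cl_iso:
  assumes f: "struct_iso \<tau> f M N" and M: "M \<in> K" and A: "A \<subseteq> univ M"
  shows "struct_iso \<tau> f (cl le M A) (cl le N (f ` A))"
proof -
  have "f ` A \<subseteq> univ N" using struct_isoD(4)[OF f] A by blast
  then have "cl le N (f ` A) = restrict_struct N (f ` univ (cl le M A))"
    using le_eq_restrict[OF cl_le[OF iso_in_K[OF M f]]] univ_cl_iso[OF assms] by metis
  then show ?thesis using iso_restrict_le(2)[OF cl_le[OF M A] f] by simp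
qed

lemma countable_cl:
  assumes N: "N \<in> K" and A: "A \<subseteq> univ N" "countable A"
  shows "countable (univ (cl le N A))"
proof -
  obtain M where M: "A \<subseteq> univ M" "(M, N) \<in> le" "|univ M| \<le>o |A| +c (natLeq :: nat rel)"
    using LST N A(1) unfolding LST_property_def by blast
  have "|A| \<le>o (natLeq :: nat rel)" using A(2) countable_card_le_natLeq by blast
  then have "|A| +c (natLeq :: nat rel) \<le>o natLeq"
    using csum_absorb2[OF natLeq_Cinfinite] ordIso_imp_ordLeq by blast
  then have "countable (univ M)" using M(3) countable_card_le_natLeq ordLeq_transitive by blast
  then show ?thesis using cl_least[OF M(2,1)] countable_subset by blast
qed

end

section \<open>Back and forth\<close>

text \<open>\<open>G\<close> is a system of graphs of partial injections. Only finite pieces of the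
  limit \<open>f\<close> are promised to lie in members of \<open>G\<close>, since the union of a
  chain need not belong to \<open>G\<close>; properties of finite character still pass to
  \<open>f\<close>.\<close>

lemma back_and_forth:
  fixes G :: "('a \<times> 'b) set set"
  assumes X: "countable X" and Y: "countable Y" and r0: "r0 \<in> G"
    and sub: "\<And>r. r \<in> G \<Longrightarrow> r \<subseteq> X \<times> Y"
    and inj: "\<And>r x y x' y'. r \<in> G \<Longrightarrow> (x, y) \<in> r \<Longrightarrow> (x', y') \<in> r \<Longrightarrow> x = x' \<longleftrightarrow> y = y'"
    and fwd: "\<And>r x. r \<in> G \<Longrightarrow> x \<in> X \<Longrightarrow> \<exists>y. insert (x, y) r \<in> G"
    and bwd: "\<And>r y. r \<in> G \<Longrightarrow> y \<in> Y \<Longrightarrow> \<exists>x. insert (x, y) r \<in> G"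
  obtains f where "bij_betw f X Y"
    "\<And>S. finite S \<Longrightarrow> S \<subseteq> X \<Longrightarrow> \<exists>r\<in>G. r0 \<subseteq> r \<and> (\<forall>x\<in>S. (x, f x) \<in> r)"
proof (cases "X = {}")
  case True
  have "Y = {}"
  proof (rule equals0I)
    fix y assume "y \<in> Y"
    then obtain x where "insert (x, y) r0 \<in> G" using bwd[OF r0] by blast
    then show False using sub[of "insert (x, y) r0"] True by simp
  qed
  then show thesis using that[of "\<lambda>x. undefined"] True r0 by (auto simp: bij_betw_def)
next
  case False
  then obtain x y where "insert (x, y) r0 \<in> G" using fwd[OF r0] by blast
  then have "Y \<noteq> {}" using sub[of "insert (x, y) r0"] by auto
  define e where "e = from_nat_into X"
  define d where "d = from_nat_into Y"
  have e: "range e = X" and d: "range d = Y"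
    unfolding e_def d_def using X Y False \<open>Y \<noteq> {}\<close> by (simp_all add: range_from_nat_into)
  \<comment> \<open>Stage \<open>n\<close> puts the \<open>n\<close>-th element of \<open>X\<close>
    into the domain and the \<open>n\<close>-th element of \<open>Y\<close> into the range. The
    enumerations may repeat, so this covers nonempty finite sets too.\<close>
  have "\<exists>R. \<forall>n. (R n \<in> G \<and> r0 \<subseteq> R n) \<and> (R n \<subseteq> R (Suc n) \<and> e n \<in> Domain (R (Suc n)) \<and> d n \<in> Range (R (Suc n)))"
  proof (rule dependent_nat_choice)
    show "\<exists>r. r \<in> G \<and> r0 \<subseteq> r" using r0 by blast
    fix r n assume r: "r \<in> G \<and> r0 \<subseteq> r"
    obtain y where y: "insert (e n, y) r \<in> G" using fwd r e by blast
    obtain x where "insert (x, d n) (insert (e n, y) r) \<in> G" using bwd[OF y] d by blast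
    then show "\<exists>r'. (r' \<in> G \<and> r0 \<subseteq> r') \<and> (r \<subseteq> r' \<and> e n \<in> Domain r' \<and> d n \<in> Range r')"
      using r by (intro exI[of _ "insert (x, d n) (insert (e n, y) r)"]) auto
  qed
  then obtain R where R: "\<And>n. R n \<in> G" "\<And>n. r0 \<subseteq> R n" "\<And>n. R n \<subseteq> R (Suc n)"
    "\<And>n. e n \<in> Domain (R (Suc n))" "\<And>n. d n \<in> Range (R (Suc n))" by blast
  have mono: "R m \<subseteq> R n" if "m \<le> n" for m n
    using R(3) that by (rule lift_Suc_mono_le)
  define T where "T = (\<Union>n. R n)"
  have inj_T: "x = x' \<longleftrightarrow> y = y'" if xy: "(x, y) \<in> T" "(x', y') \<in> T" for x y x' y'
  proof -
    obtain m n where "(x, y) \<in> R m" "(x', y') \<in> R n" using xy by (auto simp: T_def)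
    then have "(x, y) \<in> R (max m n)" "(x', y') \<in> R (max m n)"
      using mono[of m "max m n"] mono[of n "max m n"] by auto
    then show ?thesis by (rule inj[OF R(1)])
  qed
  define f where "f x = (SOME y. (x, y) \<in> T)" for x
  have fT: "(x, f x) \<in> T" if x: "x \<in> X" for x
  proof -
    obtain n where "x = e n" using x e by blast
    then have "\<exists>y. (x, y) \<in> T" using R(4)[of n] by (auto simp: T_def)
    then show ?thesis unfolding f_def by (rule someI_ex)
  qed
  have TXY: "T \<subseteq> X \<times> Y" using sub R(1) by (auto simp: T_def)
  have "bij_betw f X Y"
  proof (rule bij_betw_imageI)
    show "inj_on f X" by (rule inj_onI) (use fT inj_T in blast)
    show "f ` X = Y"
    proof
      show "f ` X \<subseteq> Y" using fT TXY by blast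
      show "Y \<subseteq> f ` X"
      proof
        fix y assume "y \<in> Y"
        then obtain n where "y = d n" using d by blast
        then obtain x where x: "(x, y) \<in> T" using R(5)[of n] by (auto simp: T_def)
        then have "x \<in> X" using TXY by blast
        moreover have "f x = y" using inj_T[OF fT[OF \<open>x \<in> X\<close>] x] by simp
        ultimately show "y \<in> f ` X" by blast
      qed
    qed
  qed
  moreover have "\<exists>r\<in>G. r0 \<subseteq> r \<and> (\<forall>x\<in>S. (x, f x) \<in> r)" if S: "finite S" "S \<subseteq> X" for S
  proof -
    have "subset.chain (range R) (range R)"
      using mono nat_le_linear unfolding subset_chain_def by blast
    moreover have "(\<lambda>x. (x, f x)) ` S \<subseteq> \<Union> (range R)" using S fT unfolding T_def by blast
    ultimately obtain r where r: "r \<in> range R" "(\<lambda>x. (x, f x)) ` S \<subseteq> r"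
      using finite_subset_Union_chain[of "(\<lambda>x. (x, f x)) ` S" "range R"] S(1) by blast
    then obtain n where "r = R n" by blast
    then have "r \<in> G" "r0 \<subseteq> r" using R(1,2) by auto
    moreover have "\<forall>x\<in>S. (x, f x) \<in> r" using r(2) by auto
    ultimately show ?thesis by blast
  qed
  ultimately show thesis using that by blast
qed

text \<open>Transport of structure along an injection; it later carries the reduct of a code into
  \<open>'u\<close>.\<close>

lemma struct_iso_image_exists:
  assumes M: "M \<in> structures \<tau>" and h: "inj_on h (univ M)"
  shows "\<exists>N. struct_iso \<tau> h M N"
proof -
  let ?g = "inv_into (univ M) h"
  define N where "N = \<lparr>univ = h ` univ M, rels = (\<lambda>s. map h ` rels M s),
    funs = (\<lambda>s ys. if ys \<in> lists (h ` univ M) \<and> \<tau> s = Some (Fun (length ys))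
      then h (funs M s (map ?g ys)) else undefined)\<rparr>"
  have g: "map ?g ys \<in> lists (univ M)" if "ys \<in> lists (h ` univ M)" for ys
    by (rule map_in_lists[OF that]) (use h in simp)
  have gh: "map ?g (map h xs) = xs" if "xs \<in> lists (univ M)" for xs
    using that h by (induction xs) auto
  have inj: "inj_on (map h) (lists (univ M))"
    by (rule inj_on_inverseI[of _ "map ?g"]) (rule gh)
  have "N \<in> structures \<tau>"
    unfolding structures_def mem_Collect_eq
  proof (intro conjI allI impI)
    fix s ys assume "ys \<in> rels N s"
    then obtain xs where xs: "ys = map h xs" "xs \<in> rels M s" by (auto simp: N_def)
    then have "xs \<in> lists (univ M)" "\<tau> s = Some (Rel (length xs))"
      using structures_relD[OF M] by blast+
    then show "ys \<in> lists (univ N)" "\<tau> s = Some (Rel (length ys))"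
      using xs(1) map_in_lists[of xs "univ M" h "h ` univ M"] by (simp_all add: N_def)
  next
    fix s ys
    show "if ys \<in> lists (univ N) \<and> \<tau> s = Some (Fun (length ys))
      then funs N s ys \<in> univ N else funs N s ys = undefined"
      using structures_funD[OF M g[of ys]] by (simp add: N_def)
  qed
  moreover have "xs \<in> rels M s \<longleftrightarrow> map h xs \<in> rels N s" if "xs \<in> lists (univ M)" for xs s
  proof
    assume "map h xs \<in> rels N s"
    then obtain xs' where "map h xs = map h xs'" "xs' \<in> rels M s" by (auto simp: N_def)
    then show "xs \<in> rels M s" using that structures_relD[OF M] inj_onD[OF inj] by metis
  qed (simp add: N_def)
  moreover have "h (funs M s xs) = funs N s (map h xs)"
    if "xs \<in> lists (univ M)" "\<tau> s = Some (Fun (length xs))" for xs s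
    using that gh[OF that(1)] map_in_lists[OF that(1), of h "h ` univ M"] by (simp add: N_def)
  ultimately have "struct_iso \<tau> h M N"
    using M h by (simp add: struct_iso_def bij_betw_def N_def)
  then show ?thesis ..
qed

section \<open>Types of finite tuples\<close>

text \<open>\<open>R\<close> represents all countable models, finite ones included. This is enough
  to represent types, because the closure of a finite tuple is countable.\<close>

locale aec_countable_types = aec_with_intersections \<tau> K le
  for \<tau> :: "'s vocab" and K :: "('u, 's) struct set" and le :: "('u, 's) struct rel" +
  fixes R :: "('u, 's) struct set"
  assumes countable_R: "countable R" and R_subset: "R \<subseteq> K"
    and R_countable: "\<And>M. M \<in> R \<Longrightarrow> countable (univ M)"
    and R_complete: "\<And>M. M \<in> K \<Longrightarrow> countable (univ M) \<Longrightarrow> \<exists>N\<in>R. \<exists>f. struct_iso \<tau> f M N"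
begin

definition pointed :: "(('u, 's) struct \<times> 'u list) set" where
  "pointed = {(M, a). M \<in> K \<and> set a \<subseteq> univ M \<and> cl le M (set a) = M}"

definition pointed_iso :: "('u, 's) struct \<times> 'u list \<Rightarrow> ('u, 's) struct \<times> 'u list \<Rightarrow> bool" where
  "pointed_iso p q \<longleftrightarrow> (\<exists>f. struct_iso \<tau> f (fst p) (fst q) \<and> map f (snd p) = snd q)"

text \<open>Isomorphic pairs may occur here several times; what counts is that \<open>reps\<close>
  is countable and meets every isomorphism class of \<open>pointed\<close>. A single pair per class
  is selected by \<open>rep\<close>.\<close>

definition reps :: "(('u, 's) struct \<times> 'u list) set" where
  "reps = {p \<in> pointed. fst p \<in> R}"

lemma countable_reps: "countable reps"
proof (rule countable_subset)
  show "reps \<subseteq> (\<Union>M\<in>R. {M} \<times> lists (univ M))" by (auto simp: reps_def pointed_def)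
  show "countable (\<Union>M\<in>R. {M} \<times> lists (univ M))"
    using countable_R R_countable by (intro countable_UN countable_SIGMA countable_lists) auto
qed

lemma repsD:
  assumes "p \<in> reps"
  shows "fst p \<in> K" "set (snd p) \<subseteq> univ (fst p)" "cl le (fst p) (set (snd p)) = fst p"
    "countable (univ (fst p))"
  using assms R_countable by (auto simp: reps_def pointed_def)

lemma pointed_iso_sym:
  assumes "p \<in> pointed" "pointed_iso p q"
  shows "pointed_iso q p"
proof -
  obtain f where f: "struct_iso \<tau> f (fst p) (fst q)" "map f (snd p) = snd q"
    using assms(2) by (auto simp: pointed_iso_def)
  have "inj_on f (univ (fst p))" using struct_isoD(5)[OF f(1)] by (simp add: bij_betw_def)
  then have "map (inv_into (univ (fst p)) f) (snd q) = map (\<lambda>x. x) (snd p)"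
    unfolding f(2)[symmetric] map_map using assms(1)
    by (intro map_cong) (auto simp: pointed_def)
  then show ?thesis using struct_iso_sym[OF f(1)] by (auto simp: pointed_iso_def)
qed

lemma pointed_iso_trans:
  assumes "pointed_iso p q" "pointed_iso q r"
  shows "pointed_iso p r"
  using assms struct_iso_trans unfolding pointed_iso_def by (metis map_map)

lemma pointed_isoI:
  assumes "(M, a) \<in> pointed" "struct_iso \<tau> f M N"
  shows "(N, map f a) \<in> pointed" "pointed_iso (M, a) (N, map f a)"
proof -
  have M: "M \<in> K" "set a \<subseteq> univ M" "cl le M (set a) = M" using assms(1) by (auto simp: pointed_def)
  have N: "N \<in> K" using iso_in_K[OF M(1) assms(2)] .
  have fa: "f ` set a \<subseteq> univ N" using struct_isoD(4)[OF assms(2)] M(2) by blast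
  have "univ (cl le N (f ` set a)) = univ N"
    using univ_cl_iso[OF assms(2) M(1,2)] M(3) struct_isoD(4)[OF assms(2)] by simp
  then have "cl le N (f ` set a) = N"
    using substructure_unique le_substructure[OF cl_le[OF N fa]] le_substructure[OF le_refl[OF N]]
    by blast
  then show "(N, map f a) \<in> pointed" using N fa by (simp add: pointed_def)
  show "pointed_iso (M, a) (N, map f a)" using assms(2) by (auto simp: pointed_iso_def)
qed

lemma reps_complete:
  assumes "p \<in> pointed"
  shows "\<exists>q\<in>reps. pointed_iso p q"
proof -
  obtain M a where p: "p = (M, a)" by (cases p)
  have M: "M \<in> K" "set a \<subseteq> univ M" "cl le M (set a) = M" using assms p by (auto simp: pointed_def)
  have "countable (univ M)"
    using countable_cl[OF M(1,2) countable_finite] M(3) by simp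
  then obtain N f where N: "N \<in> R" "struct_iso \<tau> f M N" using R_complete M(1) by blast
  show ?thesis
    using pointed_isoI[of M a f N] assms p N by (intro bexI[of _ "(N, map f a)"]) (auto simp: reps_def)
qed

text \<open>The predicate under the choice operator depends only on the isomorphism class of
  \<open>p\<close>, so isomorphic members of \<open>pointed\<close> receive literally the same
  representative.\<close>

definition rep :: "('u, 's) struct \<times> 'u list \<Rightarrow> ('u, 's) struct \<times> 'u list" where
  "rep p = (SOME q. q \<in> reps \<and> pointed_iso p q)"

lemma rep:
  assumes "p \<in> pointed"
  shows "rep p \<in> reps" "pointed_iso p (rep p)"
  using someI_ex[of "\<lambda>q. q \<in> reps \<and> pointed_iso p q"] reps_complete[OF assms]
  unfolding rep_def by blast+

lemma rep_eq_iff: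
  assumes p: "p \<in> pointed" and q: "q \<in> pointed"
  shows "rep p = rep q \<longleftrightarrow> pointed_iso p q"
proof
  assume "rep p = rep q"
  then show "pointed_iso p q"
    using rep[OF p] rep[OF q] pointed_iso_sym[OF q] pointed_iso_trans by metis
next
  assume "pointed_iso p q"
  then have "pointed_iso p r \<longleftrightarrow> pointed_iso q r" for r
    using pointed_iso_sym[OF p] pointed_iso_trans by blast
  then show "rep p = rep q" by (simp add: rep_def)
qed

text \<open>This is the Galois type of \<open>a\<close> over the empty set, which in the presence of
  intersections amounts to the isomorphism type of the closure with \<open>a\<close> distinguished.
  It is numbered through the countable set \<open>reps\<close>.\<close>

definition tp :: "('u, 's) struct \<Rightarrow> 'u list \<Rightarrow> nat" where
  "tp N a = to_nat_on reps (rep (cl le N (set a), a))"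

lemma cl_pointed: "N \<in> K \<Longrightarrow> set a \<subseteq> univ N \<Longrightarrow> (cl le N (set a), a) \<in> pointed"
  using cl_in_K cl_idem cl_extensive by (simp add: pointed_def)

lemma tp_eq_iff:
  assumes "M \<in> K" "set a \<subseteq> univ M" "N \<in> K" "set b \<subseteq> univ N"
  shows "tp M a = tp N b \<longleftrightarrow>
    (\<exists>f. struct_iso \<tau> f (cl le M (set a)) (cl le N (set b)) \<and> map f a = b)"
proof -
  note p = cl_pointed[OF assms(1,2)] and q = cl_pointed[OF assms(3,4)]
  have "tp M a = tp N b \<longleftrightarrow> rep (cl le M (set a), a) = rep (cl le N (set b), b)"
    unfolding tp_def using rep(1)[OF p] rep(1)[OF q] inj_on_to_nat_on[OF countable_reps]
    by (simp add: inj_on_eq_iff)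
  then show ?thesis using rep_eq_iff[OF p q] by (simp add: pointed_iso_def)
qed

lemma tp_iso:
  assumes f: "struct_iso \<tau> f M N" and M: "M \<in> K" and a: "set a \<subseteq> univ M"
  shows "tp N (map f a) = tp M a"
proof -
  have "set (map f a) \<subseteq> univ N" using struct_isoD(4)[OF f] a by auto
  then have "tp M a = tp N (map f a)"
    using cl_iso[OF f M a] tp_eq_iff[OF M a iso_in_K[OF M f]] by auto
  then show ?thesis ..
qed

lemma tp_sub: "(M, N) \<in> le \<Longrightarrow> set a \<subseteq> univ M \<Longrightarrow> tp M a = tp N a"
  using cl_sub by (simp add: tp_def)

section \<open>The expansion\<close>

text \<open>Every number is a relation symbol and so needs an arity. A number that is not the type
  of any tuple gets whatever \<open>from_nat_into\<close> yields, and its relation is empty in every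
  expanded model.\<close>

definition arity :: "nat \<Rightarrow> nat" where
  "arity t = length (snd (from_nat_into reps t))"

lemma arity_tp:
  assumes "N \<in> K" "set a \<subseteq> univ N"
  shows "arity (tp N a) = length a"
proof -
  note p = cl_pointed[OF assms]
  have "from_nat_into reps (tp N a) = rep (cl le N (set a), a)"
    unfolding tp_def using rep(1)[OF p] countable_reps by simp
  moreover have "length (snd (rep (cl le N (set a), a))) = length a"
    using rep(2)[OF p] unfolding pointed_iso_def by (metis length_map snd_conv)
  ultimately show ?thesis by (simp add: arity_def)
qed

definition expanded_vocab :: "('s + nat) vocab" where
  "expanded_vocab = case_sum \<tau> (\<lambda>t. Some (Rel (arity t)))"

definition expand :: "('u, 's) struct \<Rightarrow> ('u, 's + nat) struct" where
  "expand N = \<lparr>univ = univ N,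
     rels = case_sum (rels N) (\<lambda>t. {a \<in> lists (univ N). tp N a = t}),
     funs = case_sum (funs N) (\<lambda>t a. undefined)\<rparr>"

lemma expanded_vocab_simps [simp]:
  "expanded_vocab (Inl s) = \<tau> s" "expanded_vocab (Inr t) = Some (Rel (arity t))"
  by (simp_all add: expanded_vocab_def)

lemma univ_expand [simp]: "univ (expand N) = univ N"
  by (simp add: expand_def)

lemma reduct_expand [simp]: "reduct (expand N) = N"
  by (simp add: reduct_def expand_def)

lemma expand_in_structures:
  assumes N: "N \<in> K"
  shows "expand N \<in> structures expanded_vocab"
proof -
  note S = K_structures[OF N]
  have "xs \<in> lists (univ N) \<and> expanded_vocab s = Some (Rel (length xs))"
    if "xs \<in> rels (expand N) s" for s xs
    using that structures_relD[OF S] arity_tp[OF N, of xs]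
    by (cases s) (auto simp: expand_def subset_iff)
  moreover have "if xs \<in> lists (univ N) \<and> expanded_vocab s = Some (Fun (length xs))
      then funs (expand N) s xs \<in> univ N else funs (expand N) s xs = undefined" for s xs
    using structures_funD[OF S, of xs] structures_fun_undefined[OF S, of xs]
    by (cases s) (simp_all add: expand_def)
  ultimately show ?thesis unfolding structures_def by simp
qed

text \<open>A tuple of a model satisfies exactly one of the new relations, namely the one named by
  its type. Preserving these relations is therefore the same as preserving types.\<close>

lemma partial_iso_expand:
  assumes M: "M \<in> K" and N: "N \<in> K"
  shows "partial_iso expanded_vocab f A (expand M) (expand N) \<longleftrightarrow>
    partial_iso \<tau> f A M N \<and> (\<forall>a\<in>lists A. tp M a = tp N (map f a))"
proof
  assume p: "partial_iso expanded_vocab f A (expand M) (expand N)"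
  have "tp M a = tp N (map f a)" if a: "a \<in> lists A" for a
  proof -
    have "set a \<subseteq> univ M" using partial_isoD(2)[OF p] a by auto
    then have "expanded_vocab (Inr (tp M a)) = Some (Rel (length a))"
      and "a \<in> rels (expand M) (Inr (tp M a))"
      using arity_tp[OF M] by (auto simp: expand_def)
    then have "map f a \<in> rels (expand N) (Inr (tp M a))"
      using partial_isoD(4)[OF p a] by blast
    then show ?thesis by (simp add: expand_def)
  qed
  then show "partial_iso \<tau> f A M N \<and> (\<forall>a\<in>lists A. tp M a = tp N (map f a))"
    using partial_iso_reduct[of expanded_vocab f A "expand M" "expand N" \<tau>, OF p] by simp
next
  assume *: "partial_iso \<tau> f A M N \<and> (\<forall>a\<in>lists A. tp M a = tp N (map f a))"
  then have p: "partial_iso \<tau> f A M N" and t: "\<And>a. a \<in> lists A \<Longrightarrow> tp M a = tp N (map f a)"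
    by auto
  note D = partial_isoD[OF p]
  show "partial_iso expanded_vocab f A (expand M) (expand N)"
  proof (rule partial_isoI)
    fix s a assume a: "a \<in> lists A"
    have "a \<in> lists (univ M)" "map f a \<in> lists (univ N)"
      using a lists_mono[OF D(2)] map_in_lists[OF a D(3)] by blast+
    then show "a \<in> rels (expand M) s \<longleftrightarrow> map f a \<in> rels (expand N) s"
      if "expanded_vocab s = Some (Rel (length a))"
      using that t[OF a] D(4)[OF a] by (cases s) (simp_all add: expand_def)
    show "funs (expand M) s a = y \<longleftrightarrow> funs (expand N) s (map f a) = f y"
      if "expanded_vocab s = Some (Fun (length a))" "y \<in> A" for y
      using that D(5)[OF a] by (cases s) (simp_all add: expand_def)
  qed (use D in simp_all)
qed

lemma expand_iso:
  assumes f: "struct_iso \<tau> f M N" and M: "M \<in> K"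
  shows "struct_iso expanded_vocab f (expand M) (expand N)"
proof -
  have N: "N \<in> K" using iso_in_K[OF M f] .
  have "tp M a = tp N (map f a)" if "a \<in> lists (univ M)" for a
    using tp_iso[OF f M, of a] that by (simp add: in_lists_conv_set subset_iff)
  then show ?thesis
    using struct_isoD[OF f] M N expand_in_structures by (simp add: struct_iso_iff partial_iso_expand)
qed

lemma expand_substructure:
  assumes le: "(M, N) \<in> le"
  shows "substructure expanded_vocab (expand M) (expand N)"
proof -
  have "tp M a = tp N a" if "a \<in> lists (univ M)" for a
    using tp_sub[OF le, of a] that by auto
  then show ?thesis
    using le_substructure[OF le] le_in_K[OF le] expand_in_structures
    by (simp add: substructure_iff partial_iso_expand)
qed

lemma functorial_expansion_expand: "functorial_expansion \<tau> K le expanded_vocab (expand ` K)"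
  unfolding functorial_expansion_def
proof (intro conjI ballI allI impI)
  show "bij_betw reduct (expand ` K) K"
    by (auto simp: bij_betw_def inj_on_def image_image)
qed (auto simp: expand_in_structures expand_iso expand_substructure)

lemma countable_dom: "countable (dom \<tau>)"
  using LST countable_card_le_natLeq unfolding LST_property_def by blast

lemma countable_dom_expanded: "countable (dom expanded_vocab)"
proof (rule countable_subset)
  show "dom expanded_vocab \<subseteq> Inl ` dom \<tau> \<union> range Inr"
  proof
    fix s assume "s \<in> dom expanded_vocab"
    then show "s \<in> Inl ` dom \<tau> \<union> range Inr" by (cases s) auto
  qed
qed (simp add: countable_dom)

text \<open>List \<open>A\<close> as one tuple: equality of its types on both sides is by definition
  an isomorphism of closures that follows \<open>h\<close> on this tuple. Here the strength of
  types, describing whole closures, is put to use.\<close>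

lemma partial_iso_extend:
  assumes M: "M \<in> K" and N: "N \<in> K" and A: "finite A"
    and h: "partial_iso expanded_vocab h A (expand M) (expand N)"
  obtains k where "struct_iso \<tau> k (cl le M A) (cl le N (h ` A))" "\<And>x. x \<in> A \<Longrightarrow> k x = h x"
proof -
  obtain a where a: "set a = A" using A finite_list by blast
  have A': "A \<subseteq> univ M" "h ` A \<subseteq> univ N" using partial_isoD(2,3)[OF h] by simp_all
  have "a \<in> lists A" using a by auto
  then have "tp M a = tp N (map h a)" using h partial_iso_expand[OF M N] by blast
  then obtain k where k: "struct_iso \<tau> k (cl le M A) (cl le N (h ` A))" "map k a = map h a"
    using tp_eq_iff[OF M _ N, of a "map h a"] A' a by auto
  show thesis by (rule that[OF k(1)]) (use k(2) a in auto)
qed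

section \<open>Structures that are locally modelled on the class\<close>

text \<open>The closure of \<open>A\<close> as far as it can be read off from the relations of \<open>C\<close>, which need not be a
  model.\<close>

definition closure_in :: "('v, 's + nat) struct \<Rightarrow> 'v set \<Rightarrow> 'v set" where
  "closure_in C A = {x \<in> univ C. \<exists>N\<in>K. \<exists>h.
     partial_iso expanded_vocab h (insert x A) C (expand N) \<and> h x \<in> univ (cl le N (h ` A))}"

definition realizes :: "('v, 's + nat) struct \<Rightarrow> 'v list \<Rightarrow> ('u, 's) struct \<times> 'u list \<Rightarrow> bool" where
  "realizes C a p \<longleftrightarrow>
     (\<exists>h. map h a = snd p \<and> partial_iso expanded_vocab h (set a) C (expand (fst p)))"

text \<open>The last clause is the back step of a back-and-forth argument. The forth step comes for free,
  because a type determines the whole closure of its tuple.\<close>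

definition locally_modelled :: "('v, 's + nat) struct \<Rightarrow> bool" where
  "locally_modelled C \<longleftrightarrow> C \<in> structures expanded_vocab \<and>
     (\<forall>a\<in>lists (univ C). \<exists>p\<in>reps. realizes C a p \<and>
        (\<forall>y\<in>univ (fst p). \<exists>x\<in>univ C. realizes C (a @ [x]) (fst p, snd p @ [y])))"

lemma closure_in_subset: "closure_in C A \<subseteq> univ C"
  by (auto simp: closure_in_def)

lemma closure_inI:
  "N \<in> K \<Longrightarrow> partial_iso expanded_vocab h (insert x A) C (expand N) \<Longrightarrow>
    h x \<in> univ (cl le N (h ` A)) \<Longrightarrow> x \<in> closure_in C A"
  using partial_isoD(2)[of expanded_vocab h "insert x A" C "expand N"]
  unfolding closure_in_def by blast

text \<open>The existential quantifiers in \<open>closure_in\<close> can be turned into universal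
  ones. Two partial isomorphisms, into \<open>N0\<close> and into \<open>N\<close>, differ by a map
  between finite sets that preserves types. It extends to an isomorphism of closures, which carries
  the closure of the first image of \<open>A\<close> to the closure of the second.\<close>

lemma closure_inD:
  assumes x: "x \<in> closure_in C A" and A: "finite A" and N: "N \<in> K"
    and h: "partial_iso expanded_vocab h (insert x A) C (expand N)"
  shows "h x \<in> univ (cl le N (h ` A))"
proof -
  let ?A = "insert x A"
  obtain N0 h0 where N0: "N0 \<in> K" and h0: "partial_iso expanded_vocab h0 ?A C (expand N0)"
    and x0: "h0 x \<in> univ (cl le N0 (h0 ` A))"
    using x unfolding closure_in_def by blast
  let ?g = "h \<circ> inv_into ?A h0"
  have inv: "inv_into ?A h0 ` h0 ` ?A = ?A"
    using partial_isoD(1)[OF h0] by (rule inv_into_image_cancel) simp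
  have g: "partial_iso expanded_vocab ?g (h0 ` ?A) (expand N0) (expand N)"
    by (rule partial_iso_comp[OF partial_iso_inv[OF h0]]) (simp only: inv h)
  have gh: "?g (h0 z) = h z" if "z \<in> ?A" for z
    using inv_into_f_f[OF partial_isoD(1)[OF h0] that] by simp
  obtain k where k: "struct_iso \<tau> k (cl le N0 (h0 ` ?A)) (cl le N (?g ` h0 ` ?A))"
    and kg: "\<And>y. y \<in> h0 ` ?A \<Longrightarrow> k y = ?g y"
    using partial_iso_extend[OF N0 N _ g] A by blast
  have kh: "k (h0 z) = h z" if "z \<in> ?A" for z
    using kg[OF imageI[OF that]] gh[OF that] by (rule trans)
  have img: "?g ` h0 ` ?A = h ` ?A" unfolding image_image using gh by (rule image_cong[OF refl])
  have kA: "k ` h0 ` A = h ` A" unfolding image_image using kh by (intro image_cong) auto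
  have sub0: "h0 ` ?A \<subseteq> univ N0" using partial_isoD(3)[OF h0] by simp
  have sub: "h ` ?A \<subseteq> univ N" using partial_isoD(3)[OF h] by simp
  note le0 = cl_le[OF N0 sub0] and le1 = cl_le[OF N sub]
  have A0: "h0 ` A \<subseteq> univ (cl le N0 (h0 ` ?A))" and A1: "h ` A \<subseteq> univ (cl le N (h ` ?A))"
    using cl_extensive[of "h0 ` ?A" le N0] cl_extensive[of "h ` ?A" le N] by auto
  \<comment> \<open>The closures of the images of \<open>A\<close> are computed inside the closures
    of the larger sets, between which \<open>k\<close> is an isomorphism.\<close>
  have "univ (cl le N (h ` A)) = univ (cl le (cl le N (h ` ?A)) (k ` h0 ` A))"
    using cl_sub[OF le1 A1] kA by simp
  also have "\<dots> = k ` univ (cl le (cl le N0 (h0 ` ?A)) (h0 ` A))"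
    by (rule univ_cl_iso[OF _ le_in_K(1)[OF le0] A0]) (use k img in simp)
  also have "\<dots> = k ` univ (cl le N0 (h0 ` A))" using cl_sub[OF le0 A0] by simp
  finally show ?thesis using x0 kh[of x] by force
qed

text \<open>The passage from tuples to finite sets: equality of image tuples becomes agreement of
  \<open>h'\<close> with \<open>h\<close> on \<open>D\<close>, and \<open>N\<close> is generated by
  the image of \<open>D\<close> because the distinguished tuple of a representative generates
  it.\<close>

lemma locally_modelledE:
  assumes C: "locally_modelled C" and D: "finite D" "D \<subseteq> univ C"
  obtains N h where "N \<in> K" "partial_iso expanded_vocab h D C (expand N)"
    "cl le N (h ` D) = N" "countable (univ N)"
    "\<And>y. y \<in> univ N \<Longrightarrow> \<exists>x\<in>univ C. \<exists>h'. (\<forall>z\<in>D. h' z = h z) \<and> h' x = y \<and>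
       partial_iso expanded_vocab h' (insert x D) C (expand N)"
proof -
  obtain d where d: "set d = D" using D(1) finite_list by blast
  then have "d \<in> lists (univ C)" using D(2) by auto
  then obtain p where p: "p \<in> reps" "realizes C d p"
    and ext: "\<And>y. y \<in> univ (fst p) \<Longrightarrow> \<exists>x\<in>univ C. realizes C (d @ [x]) (fst p, snd p @ [y])"
    using C unfolding locally_modelled_def by blast
  obtain h where h: "map h d = snd p" "partial_iso expanded_vocab h D C (expand (fst p))"
    using p(2) d unfolding realizes_def by blast
  have hD: "h ` D = set (snd p)" using h(1) d by (metis list.set_map)
  show thesis
  proof (rule that[OF repsD(1)[OF p(1)] h(2)])
    show "cl le (fst p) (h ` D) = fst p" using repsD(3)[OF p(1)] hD by simp
    show "countable (univ (fst p))" using repsD(4)[OF p(1)] .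
    fix y assume "y \<in> univ (fst p)"
    then obtain x h' where x: "x \<in> univ C" and h': "map h' (d @ [x]) = snd p @ [y]"
      "partial_iso expanded_vocab h' (set (d @ [x])) C (expand (fst p))"
      using ext unfolding realizes_def by (metis fst_conv snd_conv)
    have "map h' d = map h d" "h' x = y" using h'(1) h(1) by auto
    then show "\<exists>x\<in>univ C. \<exists>h'. (\<forall>z\<in>D. h' z = h z) \<and> h' x = y \<and>
       partial_iso expanded_vocab h' (insert x D) C (expand (fst p))"
      using x h'(2) d by auto
  qed
qed

lemma closure_in_extensive:
  assumes C: "locally_modelled C" and A: "finite A" "A \<subseteq> univ C"
  shows "A \<subseteq> closure_in C A"
proof
  fix x assume x: "x \<in> A"
  obtain N h where N: "N \<in> K" "partial_iso expanded_vocab h A C (expand N)"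
    by (rule locally_modelledE[OF C A]) (rule that)
  have "h x \<in> univ (cl le N (h ` A))" by (rule subsetD[OF cl_extensive imageI[OF x]])
  then show "x \<in> closure_in C A" using closure_inI[OF N(1), of h x A C] N(2) x by (simp add: insert_absorb)
qed

text \<open>A partial isomorphism defined on \<open>B\<close> and \<open>x\<close> together can be
  used to test membership in both closures, and closures in a model are monotone.\<close>

lemma closure_in_mono:
  assumes C: "locally_modelled C" and B: "finite B" "B \<subseteq> univ C" and AB: "A \<subseteq> B"
  shows "closure_in C A \<subseteq> closure_in C B"
proof
  fix x assume x: "x \<in> closure_in C A"
  then have xB: "finite (insert x B)" "insert x B \<subseteq> univ C" using B x closure_in_subset[of C A] by auto
  obtain N h where N: "N \<in> K" and h: "partial_iso expanded_vocab h (insert x B) C (expand N)"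
    by (rule locally_modelledE[OF C xB]) (rule that)
  have "partial_iso expanded_vocab h (insert x A) C (expand N)"
    using h by (rule partial_iso_mono) (use AB in auto)
  then have "h x \<in> univ (cl le N (h ` A))"
    using closure_inD[OF x finite_subset[OF AB B(1)] N] by blast
  also have "\<dots> \<subseteq> univ (cl le N (h ` B))" by (rule cl_mono) (use AB in auto)
  finally show "x \<in> closure_in C B" using closure_inI[OF N h] by simp
qed

text \<open>\<open>A\<close> is sent to the generators of the model \<open>N\<close> that represents
  its type, and this map is prolonged by back and forth to all of the closure. The models that
  describe larger finite parts of \<open>C\<close> vary with the part, so each step first identifies
  a closure in such a model with \<open>N\<close>.\<close>

lemma closure_in_iso:
  assumes C: "locally_modelled C" and X: "countable (univ C)"
    and A: "finite A" "A \<subseteq> univ C"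
  obtains N f where "N \<in> K"
    "struct_iso expanded_vocab f (restrict_struct C (closure_in C A)) (expand N)"
proof -
  obtain N h0 where N: "N \<in> K" and h0: "partial_iso expanded_vocab h0 A C (expand N)"
    and gen: "cl le N (h0 ` A) = N" and cN: "countable (univ N)"
    by (rule locally_modelledE[OF C A]) (rule that)
  let ?X = "closure_in C A"
  \<comment> \<open>As \<open>g\<close> extends \<open>h0\<close>, its image generates
    \<open>N\<close>. This is what makes the closure of any copy of \<open>D\<close> a copy of
    \<open>N\<close>.\<close>
  define ok where "ok D g \<longleftrightarrow> finite D \<and> A \<subseteq> D \<and> D \<subseteq> ?X \<and>
    partial_iso expanded_vocab g D C (expand N) \<and> (\<forall>x\<in>A. g x = h0 x)" for D g
  define graph where "graph g D = (\<lambda>x. (x, g x)) ` D" for g :: "'a \<Rightarrow> 'u" and D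
  define G where "G = {graph g D |g D. ok D g}"
  have gen': "cl le N (g ` D) = N" if "ok D g" for g D
  proof -
    have sub: "g ` D \<subseteq> univ N" using that partial_isoD(3) unfolding ok_def by fastforce
    have "h0 ` A \<subseteq> g ` D" using that unfolding ok_def by force
    then have "univ N \<subseteq> univ (cl le N (g ` D))" using cl_mono[of "h0 ` A" "g ` D" le N] gen by simp
    then have "univ (cl le N (g ` D)) = univ N" using le_univ[OF cl_le[OF N sub]] by blast
    then show ?thesis
      using substructure_unique le_substructure[OF cl_le[OF N sub]] le_substructure[OF le_refl[OF N]]
      by blast
  qed
  \<comment> \<open>The inverse of \<open>h\<close> followed by \<open>g\<close> preserves types, so
    it extends to the closures, and the closure on the right is all of \<open>N\<close>.\<close>
  have transfer: "\<exists>k. struct_iso \<tau> k (cl le N' (h ` D)) N \<and> (\<forall>x\<in>D. k (h x) = g x)"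
    if ok: "ok D g" and N': "N' \<in> K" and h: "partial_iso expanded_vocab h D C (expand N')" for D g N' h
  proof -
    let ?q = "g \<circ> inv_into D h"
    have inv: "inv_into D h ` h ` D = D"
      using partial_isoD(1)[OF h] by (rule inv_into_image_cancel) simp
    have q: "partial_iso expanded_vocab ?q (h ` D) (expand N') (expand N)"
      by (rule partial_iso_comp[OF partial_iso_inv[OF h]]) (use ok inv in \<open>simp add: ok_def\<close>)
    have fin: "finite (h ` D)" using ok by (simp add: ok_def)
    obtain k where k: "struct_iso \<tau> k (cl le N' (h ` D)) (cl le N (?q ` h ` D))"
      and kq: "\<And>y. y \<in> h ` D \<Longrightarrow> k y = ?q y"
      using partial_iso_extend[OF N' N fin q] by blast
    have kh: "k (h x) = g x" if "x \<in> D" for x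
      using kq[of "h x"] inv_into_f_f[OF partial_isoD(1)[OF h] that] that by simp
    have "?q ` h ` D = g ` D" using inv by (metis image_comp)
    then show ?thesis using k kh gen'[OF ok] by auto
  qed
  \<comment> \<open>The new element is first seen in \<open>N'\<close> through \<open>h\<close> and
    then moved to \<open>N\<close> by \<open>k\<close>; so \<open>k\<close> after \<open>h\<close>
    prolongs \<open>g\<close> to \<open>x\<close>.\<close>
  have extend: "ok (insert x D) (k \<circ> h) \<and> insert (x, k (h x)) (graph g D) = graph (k \<circ> h) (insert x D)"
    if ok: "ok D g" and x: "x \<in> ?X" and N': "N' \<in> K"
      and h: "partial_iso expanded_vocab h (insert x D) C (expand N')"
      and hx: "h x \<in> univ (cl le N' (h ` D))"
      and k: "struct_iso \<tau> k (cl le N' (h ` D)) N" and kg: "\<forall>x\<in>D. k (h x) = g x" for D g N' h x k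
  proof -
    have sub: "h ` D \<subseteq> univ N'" using partial_isoD(3)[OF h] by auto
    have im: "h ` insert x D \<subseteq> univ (cl le N' (h ` D))" using hx cl_extensive[of "h ` D" le N'] by auto
    have "partial_iso expanded_vocab h (insert x D) C (expand (cl le N' (h ` D)))"
      by (subst partial_iso_sub_target[OF expand_substructure[OF cl_le[OF N' sub]]]) (use h im in simp_all)
    moreover have "partial_iso expanded_vocab k (h ` insert x D) (expand (cl le N' (h ` D))) (expand N)"
      using struct_isoD(3)[OF expand_iso[OF k cl_in_K[OF N' sub]]]
      by (rule partial_iso_mono) (use im in simp)
    ultimately have "partial_iso expanded_vocab (k \<circ> h) (insert x D) C (expand N)"
      by (rule partial_iso_comp)
    then have "ok (insert x D) (k \<circ> h)" using ok x kg by (auto simp: ok_def)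
    moreover have "insert (x, k (h x)) (graph g D) = graph (k \<circ> h) (insert x D)"
      using kg by (auto simp: graph_def image_iff)
    ultimately show ?thesis ..
  qed
  have ok0: "ok A h0" using A h0 closure_in_extensive[OF C A] by (simp add: ok_def)
  obtain f where f: "bij_betw f ?X (univ N)"
    and fG: "\<And>S. finite S \<Longrightarrow> S \<subseteq> ?X \<Longrightarrow> \<exists>r\<in>G. graph h0 A \<subseteq> r \<and> (\<forall>x\<in>S. (x, f x) \<in> r)"
  proof (rule back_and_forth[of ?X "univ N" "graph h0 A" G])
    show "countable ?X" using countable_subset[OF closure_in_subset X] .
    show "countable (univ N)" by fact
    show "graph h0 A \<in> G" using ok0 by (auto simp: G_def)
    show "r \<subseteq> ?X \<times> univ N" if r: "r \<in> G" for r
    proof -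
      obtain g D where "r = graph g D" "ok D g" using r by (auto simp: G_def)
      then show ?thesis
        using partial_isoD(3)[of expanded_vocab g D C "expand N"] by (auto simp: graph_def ok_def)
    qed
    show "x = x' \<longleftrightarrow> y = y'" if r: "r \<in> G" "(x, y) \<in> r" "(x', y') \<in> r" for r x y x' y'
    proof -
      obtain g D where g: "r = graph g D" "ok D g" using r by (auto simp: G_def)
      then have "inj_on g D" using partial_isoD(1) by (auto simp: ok_def)
      moreover have "x \<in> D" "x' \<in> D" "y = g x" "y' = g x'" using r g(1) by (auto simp: graph_def)
      ultimately show ?thesis by (auto dest: inj_onD)
    qed
    \<comment> \<open>Forth: describe \<open>D\<close> and \<open>x\<close> jointly in a model
      \<open>N'\<close>. Since \<open>x\<close> is in the closure of \<open>A\<close>, its image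
      lies in the closure of the image of \<open>D\<close>, where \<open>k\<close> is an
      isomorphism.\<close>
    show "\<exists>y. insert (x, y) r \<in> G" if r: "r \<in> G" and x: "x \<in> ?X" for r x
    proof -
      obtain g D where g: "r = graph g D" "ok D g" using r by (auto simp: G_def)
      then have D: "finite (insert x D)" "insert x D \<subseteq> univ C"
        using x closure_in_subset[of C A] by (auto simp: ok_def)
      obtain N' h where N': "N' \<in> K" and h: "partial_iso expanded_vocab h (insert x D) C (expand N')"
        by (rule locally_modelledE[OF C D]) (rule that)
      have hD: "partial_iso expanded_vocab h D C (expand N')"
        and hA: "partial_iso expanded_vocab h (insert x A) C (expand N')"
        using h by (rule partial_iso_mono; use g(2) in \<open>auto simp: ok_def\<close>)+
      have "h x \<in> univ (cl le N' (h ` A))" by (rule closure_inD[OF x A(1) N' hA])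
      then have hx: "h x \<in> univ (cl le N' (h ` D))"
        using cl_mono[of "h ` A" "h ` D" le N'] g(2) by (auto simp: ok_def)
      obtain k where "struct_iso \<tau> k (cl le N' (h ` D)) N" "\<forall>x\<in>D. k (h x) = g x"
        using transfer[OF g(2) N' hD] by blast
      then show ?thesis using extend[OF g(2) x N' h hx] g(1) unfolding G_def by blast
    qed
    \<comment> \<open>Back: now \<open>N'\<close> describes \<open>D\<close> alone and is generated
      by it, so \<open>k\<close> is onto \<open>N\<close> from the whole of \<open>N'\<close>. The
      back clause realises the preimage of \<open>y\<close> by some \<open>x\<close> in
      \<open>C\<close>.\<close>
    show "\<exists>x. insert (x, y) r \<in> G" if r: "r \<in> G" and y: "y \<in> univ N" for r y
    proof -
      obtain g D where g: "r = graph g D" "ok D g" using r by (auto simp: G_def)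
      then have D: "finite D" "D \<subseteq> univ C" using closure_in_subset[of C A] by (auto simp: ok_def)
      obtain N' h where N': "N' \<in> K" and h: "partial_iso expanded_vocab h D C (expand N')"
        and gN': "cl le N' (h ` D) = N'"
        and ext: "\<And>y. y \<in> univ N' \<Longrightarrow> \<exists>x\<in>univ C. \<exists>h'. (\<forall>z\<in>D. h' z = h z) \<and> h' x = y \<and>
          partial_iso expanded_vocab h' (insert x D) C (expand N')"
        by (rule locally_modelledE[OF C D]) (rule that)
      obtain k where k: "struct_iso \<tau> k N' N" "\<forall>x\<in>D. k (h x) = g x"
        using transfer[OF g(2) N' h] gN' by auto
      have "y \<in> k ` univ N'" using struct_isoD(4)[OF k(1)] y by simp
      then obtain y' where y': "y' \<in> univ N'" "k y' = y" by blast
      obtain x h' where x: "x \<in> univ C" and h'D: "\<forall>z\<in>D. h' z = h z" and h'x: "h' x = y'"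
        and h': "partial_iso expanded_vocab h' (insert x D) C (expand N')"
        using ext[OF y'(1)] by blast
      have im: "h' ` D = h ` D" using h'D by auto
      have k': "struct_iso \<tau> k (cl le N' (h' ` D)) N" "\<forall>x\<in>D. k (h' x) = g x"
        using k h'D gN' im by auto
      have p: "partial_iso expanded_vocab (k \<circ> h') (insert x D) C (expand N)"
      proof (rule partial_iso_comp[OF h'])
        show "partial_iso expanded_vocab k (h' ` insert x D) (expand N') (expand N)"
          using struct_isoD(3)[OF expand_iso[OF k(1) N']] partial_isoD(3)[OF h'] by (rule partial_iso_mono)
      qed
      \<comment> \<open>\<open>x\<close> belongs to the closure because the image of
        \<open>A\<close> generates the whole of \<open>N\<close>.\<close>
      have "x \<in> ?X"
      proof (rule closure_inI[OF N])
        show "partial_iso expanded_vocab (k \<circ> h') (insert x A) C (expand N)"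
          using p by (rule partial_iso_mono) (use g(2) in \<open>auto simp: ok_def\<close>)
        have "k (h' z) = h0 z" if "z \<in> A" for z using that k'(2) g(2) by (auto simp: ok_def)
        then have "(k \<circ> h') ` A = h0 ` A" by auto
        then show "(k \<circ> h') x \<in> univ (cl le N ((k \<circ> h') ` A))"
          using gen y'(2) h'x y by simp
      qed
      moreover have "h' x \<in> univ (cl le N' (h' ` D))" using h'x y'(1) im gN' by simp
      ultimately have e: "ok (insert x D) (k \<circ> h')"
        "insert (x, k (h' x)) (graph g D) = graph (k \<circ> h') (insert x D)"
        using extend[OF g(2) _ N' h' _ k'] by auto
      have "insert (x, y) r = graph (k \<circ> h') (insert x D)"
        using e(2) g(1) h'x y'(2) by simp
      then show ?thesis using e(1) unfolding G_def by blast
    qed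
  qed blast
  \<comment> \<open>Each finite part of \<open>f\<close> is contained in one of the approximations
    \<open>g\<close>.\<close>
  have "partial_iso expanded_vocab f ?X C (expand N)"
  proof (rule partial_iso_finite_character[OF closure_in_subset])
    fix S assume S: "finite S" "S \<subseteq> ?X"
    obtain r where r: "r \<in> G" "\<And>x. x \<in> S \<Longrightarrow> (x, f x) \<in> r" using fG[OF S] by blast
    obtain g D where rg: "r = graph g D" "ok D g" using r(1) unfolding G_def by blast
    have S': "x \<in> D \<and> g x = f x" if "x \<in> S" for x
      using r(2)[OF that] unfolding rg(1) graph_def by auto
    have g: "partial_iso expanded_vocab g D C (expand N)" "S \<subseteq> D" "\<And>x. x \<in> S \<Longrightarrow> g x = f x"
      using rg(2) S' by (auto simp: ok_def)
    show "partial_iso expanded_vocab f S C (expand N)"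
      by (rule partial_iso_cong[OF partial_iso_mono[OF g(1,2)] g(3)])
  qed
  moreover have "C \<in> structures expanded_vocab" using C by (simp add: locally_modelled_def)
  ultimately have "struct_iso expanded_vocab f (restrict_struct C ?X) (expand N)"
    using f expand_in_structures[OF N]
    by (intro partial_iso_imp_struct_iso) (simp_all add: bij_betw_def)
  then show thesis using that[OF N] by blast
qed

text \<open>Membership in the closure of \<open>A\<close> can be tested with any partial
  isomorphism, in particular with a restriction of \<open>f\<close>. This is what makes nested
  closures in \<open>C\<close> correspond to strong submodels.\<close>

lemma closure_in_image:
  assumes C: "locally_modelled C" and B: "finite B" "B \<subseteq> univ C" and AB: "A \<subseteq> B" and N: "N \<in> K"
    and f: "struct_iso expanded_vocab f (restrict_struct C (closure_in C B)) (expand N)"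
  shows "f ` closure_in C A = univ (cl le N (f ` A))"
proof -
  let ?X = "closure_in C B"
  have A: "finite A" "A \<subseteq> univ C" using B AB finite_subset by auto
  have CS: "C \<in> structures expanded_vocab" using C by (simp add: locally_modelled_def)
  have sub: "substructure expanded_vocab (restrict_struct C ?X) C"
    by (rule substructure_restrict[OF struct_isoD(1)[OF f] CS closure_in_subset])
  have p: "partial_iso expanded_vocab f ?X C (expand N)"
    using struct_isoD(3)[OF f] by (simp add: partial_iso_sub_source[OF sub])
  have AX: "closure_in C A \<subseteq> ?X" by (rule closure_in_mono[OF C B AB])
  have AA: "A \<subseteq> closure_in C A" by (rule closure_in_extensive[OF C A])
  show ?thesis
  proof
    show "f ` closure_in C A \<subseteq> univ (cl le N (f ` A))"
    proof
      fix y assume "y \<in> f ` closure_in C A"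
      then obtain x where x: "x \<in> closure_in C A" "y = f x" by blast
      have "partial_iso expanded_vocab f (insert x A) C (expand N)"
        using p by (rule partial_iso_mono) (use x AX AA in auto)
      then show "y \<in> univ (cl le N (f ` A))" using closure_inD[OF x(1) A(1) N] x(2) by simp
    qed
    show "univ (cl le N (f ` A)) \<subseteq> f ` closure_in C A"
    proof
      fix y assume y: "y \<in> univ (cl le N (f ` A))"
      have "f ` A \<subseteq> univ N" using partial_isoD(3)[OF p] AA AX by auto
      then have "y \<in> univ N" using y le_univ[OF cl_le[OF N]] by blast
      then obtain x where x: "x \<in> ?X" "y = f x" using struct_isoD(4)[OF f] by auto
      have "partial_iso expanded_vocab f (insert x A) C (expand N)"
        using p by (rule partial_iso_mono) (use x AX AA in auto)
      then have "x \<in> closure_in C A" by (rule closure_inI[OF N]) (use y x(2) in simp)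
      then show "y \<in> f ` closure_in C A" using x(2) by blast
    qed
  qed
qed

end

section \<open>From closures of finite sets to strong submodels and whole models\<close>

context aec_with_intersections
begin

text \<open>For infinite \<open>X\<close> the closures of initial segments of an enumeration form an
  \<omega>-chain of strong submodels of \<open>N\<close> with union \<open>X\<close>, and the
  upper-bound part of the chain axiom applies. A finite \<open>X\<close> is its own closure; it is
  treated apart since \<open>'u\<close> may then be finite and carry no limit order.\<close>

lemma le_of_finitely_closed:
  assumes N: "N \<in> K" and X: "X \<subseteq> univ N" "countable X"
    and closed: "\<And>F. finite F \<Longrightarrow> F \<subseteq> X \<Longrightarrow> univ (cl le N F) \<subseteq> X"
  shows "(restrict_struct N X, N) \<in> le"
proof (cases "finite X")
  case True
  have "univ (cl le N X) = X" using closed[OF True] cl_extensive[of X le N] by blast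
  then show ?thesis using cl_le[OF N X(1)] le_eq_restrict[OF cl_le[OF N X(1)]] by simp
next
  case False
  then have inf: "infinite (UNIV :: 'u set)" using finite_subset subset_UNIV by blast
  have NS: "N \<in> structures \<tau>" using K_structures[OF N] .
  \<comment> \<open>Each tuple of \<open>X\<close> lies in its own closure, which is a model
    contained in \<open>X\<close>; so function values stay in \<open>X\<close>.\<close>
  have RS: "restrict_struct N X \<in> structures \<tau>"
  proof (rule restrict_in_structures[OF NS X(1)])
    fix s xs assume xs: "xs \<in> lists X" and s: "\<tau> s = Some (Fun (length xs))"
    have sub: "set xs \<subseteq> X" using xs by auto
    let ?c = "cl le N (set xs)"
    have c: "(?c, N) \<in> le" using cl_le[OF N] sub X(1) by blast
    have xsc: "xs \<in> lists (univ ?c)" using cl_extensive[of "set xs" le N] by auto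
    have "funs ?c s xs \<in> univ ?c"
      by (rule structures_funD[OF K_structures[OF le_in_K(1)[OF c]] xsc s])
    moreover have "funs ?c s xs = funs N s xs"
      using funs_restrict[OF xsc, of N s] le_eq_restrict[OF c] by metis
    ultimately show "funs N s xs \<in> X" using closed[OF finite_set sub] by auto
  qed
  define e where "e = from_nat_into X"
  have e: "range e = X" unfolding e_def using X(2) False by (intro range_from_nat_into) auto
  define M where "M n = cl le N (e ` {..<n})" for n
  have eN: "e ` {..<n} \<subseteq> univ N" for n using e X(1) by auto
  have M: "(M n, N) \<in> le" for n unfolding M_def by (rule cl_le[OF N eN])
  have step: "(M n, M (Suc n)) \<in> le" for n
    by (rule le_within[OF M M]) (simp only: M_def, rule cl_mono, auto)
  have MX: "univ (M n) \<subseteq> X" for n unfolding M_def using e by (intro closed) auto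
  have "univ (restrict_struct N X) = (\<Union>n. univ (M n))"
  proof
    show "univ (restrict_struct N X) \<subseteq> (\<Union>n. univ (M n))"
    proof
      fix x assume "x \<in> univ (restrict_struct N X)"
      then obtain n where "x = e n" using e by auto
      then have "x \<in> univ (M (Suc n))"
        unfolding M_def using cl_extensive[of "e ` {..<Suc n}" le N] by auto
      then show "x \<in> (\<Union>n. univ (M n))" by blast
    qed
  qed (use MX in auto)
  moreover have "substructure \<tau> (M n) (restrict_struct N X)" for n
    using substructure_within[OF le_substructure[OF M] substructure_restrict[OF RS NS X(1)]] MX
    by simp
  ultimately show ?thesis using omega_union(3)[where M = M, OF inf step RS] M by blast
qed

end

context aec_countable_types
begin

text \<open>The closure of the image of a tuple is isomorphic to a representative \<open>q\<close>.
  Since \<open>f\<close> is onto, every element of this closure, hence of \<open>q\<close>, comes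
  from \<open>C\<close>, which gives the back clause.\<close>

lemma locally_modelled_of_iso:
  assumes f: "struct_iso expanded_vocab f C (expand N)" and N: "N \<in> K"
  shows "locally_modelled C"
  unfolding locally_modelled_def
proof (intro conjI ballI)
  show "C \<in> structures expanded_vocab" using struct_isoD(1)[OF f] .
  fix a assume "a \<in> lists (univ C)"
  then have a: "set a \<subseteq> univ C" by auto
  have fC: "f ` univ C = univ N" using struct_isoD(4)[OF f] by simp
  have b: "set (map f a) \<subseteq> univ N" using a fC by auto
  define M where "M = cl le N (set (map f a))"
  have MN: "(M, N) \<in> le" unfolding M_def by (rule cl_le[OF N b])
  have p: "(M, map f a) \<in> pointed" unfolding M_def by (rule cl_pointed[OF N b])
  have bM: "f ` set a \<subseteq> univ M" using p by (simp add: pointed_def)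
  obtain q where q: "q \<in> reps" "pointed_iso (M, map f a) q" using reps_complete[OF p] by blast
  then obtain g where g: "struct_iso \<tau> g M (fst q)" "map g (map f a) = snd q"
    by (auto simp: pointed_iso_def)
  note g' = expand_iso[OF g(1) le_in_K(1)[OF MN]]
  have p_iso: "partial_iso expanded_vocab (g \<circ> f) A C (expand (fst q))"
    if A: "A \<subseteq> univ C" "f ` A \<subseteq> univ M" for A
  proof (rule partial_iso_comp)
    have "partial_iso expanded_vocab f A C (expand N)"
      using struct_isoD(3)[OF f] A(1) by (rule partial_iso_mono)
    then show "partial_iso expanded_vocab f A C (expand M)"
      by (subst partial_iso_sub_target[OF expand_substructure[OF MN]]) (use A in simp_all)
    show "partial_iso expanded_vocab g (f ` A) (expand M) (expand (fst q))"
      using struct_isoD(3)[OF g'] by (rule partial_iso_mono) (use A in simp)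
  qed
  show "\<exists>p\<in>reps. realizes C a p \<and>
      (\<forall>y\<in>univ (fst p). \<exists>x\<in>univ C. realizes C (a @ [x]) (fst p, snd p @ [y]))"
  proof (intro bexI[OF _ q(1)] conjI ballI)
    show "realizes C a q"
      unfolding realizes_def using p_iso[OF a bM] g(2) by (intro exI[of _ "g \<circ> f"]) simp
    fix y assume "y \<in> univ (fst q)"
    then have "y \<in> g ` univ M" using struct_isoD(4)[OF g(1)] by simp
    then obtain z where z: "z \<in> univ M" "y = g z" by blast
    then have "z \<in> f ` univ C" using le_univ[OF MN] fC by blast
    then obtain x where x: "x \<in> univ C" "z = f x" by blast
    have "partial_iso expanded_vocab (g \<circ> f) (set (a @ [x])) C (expand (fst q))"
      by (rule p_iso) (use a bM x z in auto)
    then have "realizes C (a @ [x]) (fst q, snd q @ [y])"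
      unfolding realizes_def using g(2) x z by (intro exI[of _ "g \<circ> f"]) simp
    then show "\<exists>x\<in>univ C. realizes C (a @ [x]) (fst q, snd q @ [y])" using x(1) by blast
  qed
qed

text \<open>Finite parts of \<open>C\<close> of every size inject into models over
  \<open>'u\<close>. The infinity of \<open>'u\<close> is what both the \<omega>-chain and the copy
  of \<open>C\<close> in \<open>'u\<close> require.\<close>

lemma infinite_UNIV_if_locally_modelled:
  assumes C: "locally_modelled C" and inf: "infinite (univ C)" and X: "countable (univ C)"
  shows "infinite (UNIV :: 'u set)"
proof
  assume fin: "finite (UNIV :: 'u set)"
  obtain A where A: "finite A" "card A = Suc (card (UNIV :: 'u set))" "A \<subseteq> univ C"
    using infinite_arbitrarily_large[OF inf] by blast
  obtain N h where h: "partial_iso expanded_vocab h A C (expand N)"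
    by (rule locally_modelledE[OF C A(1,3)]) (rule that)
  have "card A \<le> card (UNIV :: 'u set)"
    using card_inj_on_le[OF partial_isoD(1)[OF h] subset_UNIV fin] .
  then show False using A(2) by simp
qed

text \<open>The closures of an exhausting sequence of finite sets are models up to isomorphism, but
  the isomorphisms \<open>f n\<close> need not extend one another. Copying the reduct of
  \<open>C\<close> into \<open>'u\<close> by one injection \<open>h\<close> turns the closures into
  a genuine chain inside the copy \<open>U\<close>. A finite \<open>C\<close> is the closure of its
  own universe.\<close>

lemma iso_of_locally_modelled:
  fixes C :: "('v, 's + nat) struct"
  assumes C: "locally_modelled C" and X: "countable (univ C)"
  shows "\<exists>N\<in>K. \<exists>f. struct_iso expanded_vocab f C (expand N)"
proof (cases "finite (univ C)")
  case True
  have CS: "C \<in> structures expanded_vocab" using C by (simp add: locally_modelled_def)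
  have "closure_in C (univ C) = univ C"
    using closure_in_extensive[OF C True] closure_in_subset[of C "univ C"] by blast
  then have "restrict_struct C (closure_in C (univ C)) = C" using restrict_univ[OF CS] by simp
  then show ?thesis using closure_in_iso[OF C X True order_refl] by metis
next
  case False
  have CS: "C \<in> structures expanded_vocab" using C by (simp add: locally_modelled_def)
  have inf: "infinite (UNIV :: 'u set)" by (rule infinite_UNIV_if_locally_modelled[OF C False X])
  obtain h0 :: "nat \<Rightarrow> 'u" where h0: "inj h0" using infinite_countable_subset[OF inf] by blast
  define h where "h = h0 \<circ> to_nat_on (univ C)"
  have h: "inj_on h (univ C)"
    unfolding h_def using inj_on_to_nat_on[OF X] h0 by (intro comp_inj_on) (auto intro: inj_on_subset)
  define c where "c = from_nat_into (univ C)"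
  have c: "range c = univ C" unfolding c_def using X False by (intro range_from_nat_into) auto
  define A where "A n = c ` {..<n}" for n
  have A: "finite (A n)" "A n \<subseteq> univ C" for n using c by (auto simp: A_def)
  have A_mono: "A n \<subseteq> A (Suc n)" for n by (auto simp: A_def)
  define D where "D n = closure_in C (A n)" for n
  have AD: "A n \<subseteq> D n" for n unfolding D_def by (rule closure_in_extensive[OF C A])
  have DC: "D n \<subseteq> univ C" for n unfolding D_def by (rule closure_in_subset)
  have D_mono: "D n \<subseteq> D (Suc n)" for n
    unfolding D_def by (rule closure_in_mono[OF C A A_mono])
  have "\<exists>N f. N \<in> K \<and> struct_iso expanded_vocab f (restrict_struct C (D n)) (expand N)" for n
    unfolding D_def by (rule closure_in_iso[OF C X A(1,2)[of n]]) blast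
  then obtain N f where N: "\<And>n. N n \<in> K"
    and f: "\<And>n. struct_iso expanded_vocab (f n) (restrict_struct C (D n)) (expand (N n))"
    by metis
  have redS: "reduct C \<in> structures \<tau>" by (rule reduct_in_structures[OF CS]) simp
  obtain U where U: "struct_iso \<tau> h (reduct C) U"
    using struct_iso_image_exists[OF redS, of h] h by auto
  have US: "U \<in> structures \<tau>" using struct_isoD(2)[OF U] .
  have univU: "univ U = h ` univ C" using struct_isoD(4)[OF U] by simp
  define m where "m n = restrict_struct U (h ` D n)" for n
  have red_restrict: "reduct (restrict_struct C Y) = restrict_struct (reduct C) Y" for Y
    by (rule struct.equality) (auto simp: reduct_def restrict_struct_def fun_eq_iff)
  have redf: "struct_iso \<tau> (f n) (restrict_struct (reduct C) (D n)) (N n)" for n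
    using struct_iso_reduct[OF f[of n], of \<tau>] by (simp add: red_restrict)
  have hm: "struct_iso \<tau> h (restrict_struct (reduct C) (D n)) (m n)" for n
    unfolding m_def by (rule struct_iso_restrict[OF U]) (use DC struct_isoD(1)[OF redf] in auto)
  \<comment> \<open>\<open>e n\<close> compares the abstract model \<open>N n\<close> with the
    actual piece \<open>m n\<close> of \<open>U\<close>; on the closure \<open>D n\<close>, applying
    \<open>f n\<close> and then \<open>e n\<close> is the same as applying \<open>h\<close>.\<close>
  define e where "e n = h \<circ> inv_into (D n) (f n)" for n
  have e: "struct_iso \<tau> (e n) (N n) (m n)" for n
    using struct_iso_trans[OF struct_iso_sym[OF redf] hm] by (simp add: e_def)
  have inj_f: "inj_on (f n) (D n)" for n
    using struct_isoD(5)[OF redf[of n]] by (simp add: bij_betw_def)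
  have ef: "e n (f n x) = h x" if "x \<in> D n" for n x
    using inv_into_f_f[OF inj_f that] by (simp add: e_def)
  have mS: "m n \<in> structures \<tau>" for n using struct_isoD(2)[OF e] .
  have hDU: "h ` D n \<subseteq> univ U" for n using univU DC by (simp add: image_mono)
  have subU: "substructure \<tau> (m n) U" for n
    using substructure_restrict[OF _ US hDU] mS unfolding m_def by blast
  have step: "(m n, m (Suc n)) \<in> le" for n
  proof -
    let ?k = "Suc n"
    have fA: "f ?k ` A n \<subseteq> univ (N ?k)"
      using struct_isoD(4)[OF f[of ?k]] A_mono[of n] AD[of ?k] by auto
    \<comment> \<open>Under \<open>f ?k\<close> the smaller closure becomes a closure in the model
      \<open>N ?k\<close> and is therefore strong there; \<open>e ?k\<close> carries this over to
      \<open>m n\<close> inside \<open>m ?k\<close>.\<close>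
    have im: "f ?k ` D n = univ (cl le (N ?k) (f ?k ` A n))"
      unfolding D_def
      by (rule closure_in_image[OF C A A_mono N]) (use f in \<open>simp only: D_def\<close>)
    have "e ?k ` univ (cl le (N ?k) (f ?k ` A n)) = h ` D n"
      unfolding im[symmetric] image_image using ef D_mono by (intro image_cong) auto
    then have "(restrict_struct (m ?k) (h ` D n), m ?k) \<in> le"
      using iso_restrict_le(1)[OF cl_le[OF N fA] e] by simp
    moreover have "restrict_struct (m ?k) (h ` D n) = m n"
      unfolding m_def by (rule restrict_restrict) (use D_mono in auto)
    ultimately show ?thesis by simp
  qed
  have cover: "\<exists>n. S \<subseteq> A n" if S: "finite S" "S \<subseteq> univ C" for S
  proof -
    obtain I where I: "finite I" "S = c ` I" using finite_subset_image[of S c UNIV] S c by auto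
    then obtain n where "I \<subseteq> {..<n}" using finite_nat_iff_bounded by blast
    then show ?thesis using I(2) unfolding A_def by blast
  qed
  have "univ U = (\<Union>n. univ (m n))"
  proof
    show "univ U \<subseteq> (\<Union>n. univ (m n))"
    proof
      fix y assume "y \<in> univ U"
      then obtain x where x: "x \<in> univ C" "y = h x" using univU by blast
      then obtain n where "{x} \<subseteq> A n" using cover[of "{x}"] by auto
      then show "y \<in> (\<Union>n. univ (m n))" using x(2) AD[of n] by (auto simp: m_def)
    qed
    show "(\<Union>n. univ (m n)) \<subseteq> univ U" using hDU by (simp add: m_def UN_subset_iff)
  qed
  note om = omega_union[where M = m, OF inf step US subU this]
  have UK: "U \<in> K" using om(1) .
  \<comment> \<open>The chain argument only concerns the old vocabulary. That \<open>h\<close>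
    respects types is checked on finite sets, each inside some \<open>D n\<close>, where
    \<open>h\<close> is an isomorphism onto the expansion of \<open>m n\<close>; types in
    \<open>m n\<close> and in \<open>U\<close> coincide.\<close>
  have "partial_iso expanded_vocab h (univ C) C (expand U)"
  proof (rule partial_iso_finite_character[OF order_refl])
    fix S assume S: "finite S" "S \<subseteq> univ C"
    then obtain n where n: "S \<subseteq> A n" using cover by blast
    have CnS: "restrict_struct C (D n) \<in> structures expanded_vocab" using struct_isoD(1)[OF f] .
    have "struct_iso expanded_vocab (e n \<circ> f n) (restrict_struct C (D n)) (expand (m n))"
      by (rule struct_iso_trans[OF f expand_iso[OF e N]])
    then have "struct_iso expanded_vocab h (restrict_struct C (D n)) (expand (m n))"
      by (rule struct_iso_cong) (simp add: ef)
    then have p: "partial_iso expanded_vocab h (D n) (restrict_struct C (D n)) (expand (m n))"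
      using struct_isoD(3) by fastforce
    have "partial_iso expanded_vocab h (D n) C (expand (m n))"
      using p by (simp add: partial_iso_sub_source[OF substructure_restrict[OF CnS CS DC]])
    then have "partial_iso expanded_vocab h (D n) C (expand U)"
      using partial_iso_sub_target[OF expand_substructure[OF om(2)], of h "D n" n C]
        partial_isoD(3)[of expanded_vocab h "D n" C "expand (m n)"] by blast
    then show "partial_iso expanded_vocab h S C (expand U)"
      by (rule partial_iso_mono) (use n AD in blast)
  qed
  then have "struct_iso expanded_vocab h C (expand U)"
    using CS UK expand_in_structures univU by (simp add: struct_iso_iff)
  then show ?thesis using UK by blast
qed

lemma codes_expand: "codes expanded_vocab (expand ` K) = {C. locally_modelled C}"
  using locally_modelled_of_iso iso_of_locally_modelled[OF _ countableI_type]
  unfolding codes_def by blast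

text \<open>The condition on closures cannot be dropped: if \<open>le\<close> is equality on the class of all countably
  infinite sets, then the expansion of each infinite subset of a model is a substructure.\<close>

lemma codes_le_expand:
  "codes_le expanded_vocab (expansion_le le (expand ` K)) =
    {(C, D). substructure expanded_vocab C D \<and> locally_modelled D \<and>
       (\<forall>a\<in>lists (univ C). closure_in D (set a) \<subseteq> univ C)}" (is "?L = ?R")
proof (intro set_eqI iffI)
  fix p assume "p \<in> ?L"
  then obtain C D M N f where p: "p = (C, D)" and CD: "univ C \<subseteq> univ D" and le: "(M, N) \<in> le"
    and fC: "struct_iso expanded_vocab f C (expand M)"
    and fD: "struct_iso expanded_vocab f D (expand N)"
    by (auto simp: codes_le_def expansion_le_def)
  note NK = le_in_K[OF le]
  have pD: "partial_iso expanded_vocab f (univ C) D (expand N)"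
    using struct_isoD(3)[OF fD] CD by (rule partial_iso_mono)
  \<comment> \<open>The same \<open>f\<close> maps \<open>C\<close> and \<open>D\<close> into
    \<open>expand N\<close>, so following it by its inverse compares \<open>C\<close> with
    \<open>D\<close> through the identity.\<close>
  have "partial_iso expanded_vocab f (univ C) C (expand N)"
    using struct_isoD(3)[OF fC] partial_isoD(3)[OF struct_isoD(3)[OF fC]]
    by (subst partial_iso_sub_target[OF expand_substructure[OF le], symmetric])
  from partial_iso_comp[OF this partial_iso_inv[OF pD]]
  have "partial_iso expanded_vocab (\<lambda>x. x) (univ C) C D"
    by (rule partial_iso_cong) (use inv_into_f_f[OF partial_isoD(1)[OF pD]] in simp)
  then have "substructure expanded_vocab C D"
    using struct_isoD(1)[OF fC] struct_isoD(1)[OF fD] by (simp add: substructure_iff)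
  moreover have "closure_in D (set a) \<subseteq> univ C" if a: "a \<in> lists (univ C)" for a
  proof
    fix x assume x: "x \<in> closure_in D (set a)"
    then have xD: "x \<in> univ D" using closure_in_subset[of D "set a"] by blast
    have aC: "set a \<subseteq> univ C" using a by auto
    have fCM: "f ` univ C = univ M" using struct_isoD(4)[OF fC] by simp
    have "partial_iso expanded_vocab f (insert x (set a)) D (expand N)"
      using struct_isoD(3)[OF fD] by (rule partial_iso_mono) (use xD aC CD in auto)
    then have "f x \<in> univ (cl le N (f ` set a))" by (rule closure_inD[OF x finite_set NK(2)])
    also have "\<dots> \<subseteq> univ M" by (rule cl_least[OF le]) (use aC fCM in auto)
    finally obtain z where "z \<in> univ C" "f x = f z" unfolding fCM[symmetric] by blast
    then show "x \<in> univ C"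
      using partial_isoD(1)[OF struct_isoD(3)[OF fD]] xD CD by (auto dest!: inj_onD)
  qed
  ultimately show "p \<in> ?R" using p locally_modelled_of_iso[OF fD NK(2)] by blast
next
  fix p assume "p \<in> ?R"
  then obtain C D where p: "p = (C, D)" and sub: "substructure expanded_vocab C D"
    and D: "locally_modelled D" and closed: "\<And>a. a \<in> lists (univ C) \<Longrightarrow> closure_in D (set a) \<subseteq> univ C"
    by blast
  obtain N f where N: "N \<in> K" and f: "struct_iso expanded_vocab f D (expand N)"
    using iso_of_locally_modelled[OF D] by auto
  have CD: "univ C \<subseteq> univ D" and CS: "C \<in> structures expanded_vocab"
    and CR: "restrict_struct D (univ C) = C" using sub by (auto simp: substructure_def)
  have fD: "f ` univ D = univ N" using struct_isoD(4)[OF f] by simp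
  let ?X = "f ` univ C"
  have XN: "?X \<subseteq> univ N" using fD CD by blast
  \<comment> \<open>A finite subset of the image of \<open>C\<close> is the image of a tuple of
    \<open>C\<close>, so the condition on closures in \<open>D\<close> becomes the hypothesis of
    \<open>le_of_finitely_closed\<close>.\<close>
  have "(restrict_struct N ?X, N) \<in> le"
  proof (rule le_of_finitely_closed[OF N XN])
    fix F assume F: "finite F" "F \<subseteq> ?X"
    obtain A where A: "A \<subseteq> univ C" "finite A" "F = f ` A"
      using finite_subset_image[OF F] by blast
    obtain a where a: "set a = A" using finite_list[OF A(2)] by blast
    have "a \<in> lists (univ C)" using a A(1) by auto
    then have cC: "closure_in D A \<subseteq> univ C" using closed a by blast
    show "univ (cl le N F) \<subseteq> ?X"
    proof
      fix y assume y: "y \<in> univ (cl le N F)"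
      then have "y \<in> univ N" using le_univ[OF cl_le[OF N]] F(2) XN by blast
      then obtain x where x: "x \<in> univ D" "y = f x" using fD by blast
      have "partial_iso expanded_vocab f (insert x A) D (expand N)"
        using struct_isoD(3)[OF f] by (rule partial_iso_mono) (use x A(1) CD in auto)
      then have "x \<in> closure_in D A" by (rule closure_inI[OF N]) (use y x(2) A(3) in simp)
      then show "y \<in> ?X" using cC x(2) by blast
    qed
  qed simp
  then have le: "(expand (restrict_struct N ?X), expand N) \<in> expansion_le le (expand ` K)"
    and sub': "substructure expanded_vocab (expand (restrict_struct N ?X)) (expand N)"
    using le_in_K expand_substructure by (auto simp: expansion_le_def)
  have "expand (restrict_struct N ?X) = restrict_struct (expand N) ?X"
    using sub' by (simp add: substructure_def)
  then have "struct_iso expanded_vocab f C (expand (restrict_struct N ?X))"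
    using struct_iso_restrict[OF f CD] CR CS by simp
  then show "p \<in> ?L" using p CD le f unfolding codes_le_def by blast
qed

end

section \<open>Measurability\<close>

lemma code_space_generators:
  "{{C \<in> structures \<tau>. a \<in> univ C} |a. True} \<union>
   {{C \<in> structures \<tau>. xs \<in> rels C s} |s xs. True} \<union>
   {{C \<in> structures \<tau>. xs \<in> lists (univ C) \<and> funs C s xs = a} |s xs a. True}
   \<subseteq> Pow (structures \<tau>)"
  by auto

lemma space_code_space: "space (code_space \<tau>) = structures \<tau>"
  unfolding code_space_def by (rule space_measure_of[OF code_space_generators])

text \<open>The generators mention function values only under the guard
  \<open>xs \<in> lists (univ C)\<close>; later formulas are brought into this guarded form.\<close>

lemma pred_code_space:
  shows pred_code_univ [measurable]: "Measurable.pred (code_space \<tau>) (\<lambda>C. a \<in> univ C)"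
    and pred_code_rels [measurable]: "Measurable.pred (code_space \<tau>) (\<lambda>C. xs \<in> rels C s)"
    and pred_code_funs [measurable]:
      "Measurable.pred (code_space \<tau>) (\<lambda>C. xs \<in> lists (univ C) \<and> funs C s xs = y)"
  unfolding pred_def space_code_space
  by (simp_all only: code_space_def, rule_tac [!] in_measure_of[OF code_space_generators]) blast+

lemma pred_constant: "Measurable.pred M (\<lambda>x. c)"
  by simp

lemma pred_code_lists [measurable]: "Measurable.pred (code_space \<tau>) (\<lambda>C. xs \<in> lists (univ C))"
  unfolding in_lists_conv_set by measurable

text \<open>The quantifier over symbols is restricted to \<open>dom \<tau>\<close>, as the type of
  symbols may be uncountable; the clauses are void for other symbols. Tuples are lists of natural
  numbers, and the guard on function values follows from \<open>A\<close> lying in the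
  universe.\<close>

lemma pred_partial_iso:
  fixes D :: "('v, 's) struct" and A :: "nat set"
  assumes dom: "countable (dom \<tau>)"
  shows "Measurable.pred (code_space \<tau>) (\<lambda>C. partial_iso \<tau> f A C D)"
proof -
  have eq: "partial_iso \<tau> f A C D \<longleftrightarrow> (inj_on f A \<and> f ` A \<subseteq> univ D) \<and> (\<forall>a\<in>A. a \<in> univ C) \<and>
      (\<forall>s\<in>dom \<tau>. \<forall>xs\<in>lists A.
        (\<tau> s = Some (Rel (length xs)) \<longrightarrow> (xs \<in> rels C s \<longleftrightarrow> map f xs \<in> rels D s)) \<and>
        (\<tau> s = Some (Fun (length xs)) \<longrightarrow>
          (\<forall>y\<in>A. xs \<in> lists (univ C) \<and> funs C s xs = y \<longleftrightarrow> funs D s (map f xs) = f y)))" for C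
  proof (cases "A \<subseteq> univ C")
    case True
    have l: "xs \<in> lists (univ C)" if "xs \<in> lists A" for xs using lists_mono[OF True] that by blast
    let ?Q = "\<lambda>s. \<forall>xs\<in>lists A.
        (\<tau> s = Some (Rel (length xs)) \<longrightarrow> (xs \<in> rels C s \<longleftrightarrow> map f xs \<in> rels D s)) \<and>
        (\<tau> s = Some (Fun (length xs)) \<longrightarrow>
          (\<forall>y\<in>A. funs C s xs = y \<longleftrightarrow> funs D s (map f xs) = f y))"
    have "(\<forall>s. ?Q s) \<longleftrightarrow> (\<forall>s\<in>dom \<tau>. ?Q s)" by (auto simp: domIff)
    moreover have "A \<subseteq> univ C \<longleftrightarrow> (\<forall>a\<in>A. a \<in> univ C)" by blast
    ultimately show ?thesis using True unfolding partial_iso_def by (simp add: l cong: ball_cong)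
  next
    case False
    then show ?thesis unfolding partial_iso_def by blast
  qed
  show ?thesis
    unfolding eq
    by (intro pred_intros_logic measurable_pred_countable(1)[OF dom] pred_intros_countable_bounded
        pred_intros_imp' pred_code_space pred_constant)
qed

text \<open>The same rewriting with two variable structures: being structures is part of the ambient
  space, equality of function values is split over the countably many \<open>y\<close>, and each
  atom concerns a single coordinate.\<close>

lemma pred_substructure:
  assumes dom: "countable (dom \<tau>)"
  shows "Measurable.pred (code_space \<tau> \<Otimes>\<^sub>M code_space \<tau>) (\<lambda>p. substructure \<tau> (fst p) (snd p))"
proof -
  let ?S = "code_space \<tau> \<Otimes>\<^sub>M code_space \<tau>"
  let ?P = "\<lambda>C D. (\<forall>x. x \<in> univ C \<longrightarrow> x \<in> univ D) \<and>
      (\<forall>s\<in>dom \<tau>. \<forall>xs. xs \<in> lists (univ C) \<longrightarrow>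
        (\<tau> s = Some (Rel (length xs)) \<longrightarrow> (xs \<in> rels C s \<longleftrightarrow> xs \<in> rels D s)) \<and>
        (\<tau> s = Some (Fun (length xs)) \<longrightarrow>
          (\<forall>y. y \<in> univ C \<longrightarrow> (xs \<in> lists (univ C) \<and> funs C s xs = y \<longleftrightarrow>
                                xs \<in> lists (univ D) \<and> funs D s xs = y))))"
  have eq: "substructure \<tau> (fst p) (snd p) \<longleftrightarrow> ?P (fst p) (snd p)" if "p \<in> space ?S" for p
  proof -
    have p: "fst p \<in> structures \<tau>" "snd p \<in> structures \<tau>"
      using that by (auto simp: space_pair_measure space_code_space)
    have l: "xs \<in> lists (univ (snd p))" if "univ (fst p) \<subseteq> univ (snd p)" "xs \<in> lists (univ (fst p))" for xs
      using lists_mono[OF that(1)] that(2) by blast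
    let ?Q = "\<lambda>C D s. \<forall>xs\<in>lists (univ C).
        (\<tau> s = Some (Rel (length xs)) \<longrightarrow> (xs \<in> rels C s \<longleftrightarrow> xs \<in> rels D s)) \<and>
        (\<tau> s = Some (Fun (length xs)) \<longrightarrow> (\<forall>y\<in>univ C. funs C s xs = y \<longleftrightarrow> funs D s xs = y))"
    have "(\<forall>s. ?Q (fst p) (snd p) s) \<longleftrightarrow> (\<forall>s\<in>dom \<tau>. ?Q (fst p) (snd p) s)"
      by (auto simp: domIff)
    then have "substructure \<tau> (fst p) (snd p) \<longleftrightarrow>
        univ (fst p) \<subseteq> univ (snd p) \<and> (\<forall>s\<in>dom \<tau>. ?Q (fst p) (snd p) s)"
      using p unfolding substructure_iff partial_iso_def by simp
    moreover have "univ (fst p) \<subseteq> univ (snd p) \<longleftrightarrow> (\<forall>x. x \<in> univ (fst p) \<longrightarrow> x \<in> univ (snd p))"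
      by blast
    moreover have "?Q (fst p) (snd p) s \<longleftrightarrow> (\<forall>xs. xs \<in> lists (univ (fst p)) \<longrightarrow>
        (\<tau> s = Some (Rel (length xs)) \<longrightarrow> (xs \<in> rels (fst p) s \<longleftrightarrow> xs \<in> rels (snd p) s)) \<and>
        (\<tau> s = Some (Fun (length xs)) \<longrightarrow>
          (\<forall>y. y \<in> univ (fst p) \<longrightarrow> (xs \<in> lists (univ (fst p)) \<and> funs (fst p) s xs = y \<longleftrightarrow>
                                xs \<in> lists (univ (snd p)) \<and> funs (snd p) s xs = y))))"
      if "univ (fst p) \<subseteq> univ (snd p)" for s
      unfolding Ball_def using l[OF that] by (simp cong: imp_cong)
    ultimately show ?thesis by (simp cong: conj_cong)
  qed
  have *: "Measurable.pred ?S (\<lambda>p. Q (fst p))" "Measurable.pred ?S (\<lambda>p. Q (snd p))"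
    if "Measurable.pred (code_space \<tau>) Q" for Q
    using measurable_compose[OF measurable_fst that] measurable_compose[OF measurable_snd that] by auto
  have "Measurable.pred ?S (\<lambda>p. ?P (fst p) (snd p))"
    by (intro pred_intros_logic measurable_pred_countable(1)[OF dom] pred_intros_countable
        pred_constant *[OF pred_code_univ] *[OF pred_code_rels] *[OF pred_code_funs]
        *[OF pred_code_lists])
  then show ?thesis using eq by (simp cong: measurable_cong)
qed

section \<open>Borel codes for the expanded class and analytic codes for the original one\<close>

context aec_countable_types
begin

text \<open>The quantifier over maps is harmless: all \<open>h\<close> with
  \<open>map h a = snd p\<close> agree on \<open>set a\<close>, so one fixed witness serves for
  every \<open>C\<close>.\<close>

lemma pred_realizes:
  "Measurable.pred (code_space expanded_vocab) (\<lambda>C. realizes C a p)"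
proof (cases "\<exists>h. map h a = snd p")
  case True
  then obtain h where h: "map h a = snd p" by blast
  have "realizes C a p \<longleftrightarrow> partial_iso expanded_vocab h (set a) C (expand (fst p))" for C
  proof
    assume "realizes C a p"
    then obtain g where g: "map g a = snd p"
      "partial_iso expanded_vocab g (set a) C (expand (fst p))"
      by (auto simp: realizes_def)
    have "map g a = map h a" using g(1) h by simp
    then have "g x = h x" if "x \<in> set a" for x using that by simp
    then show "partial_iso expanded_vocab h (set a) C (expand (fst p))"
      by (rule partial_iso_cong[OF g(2)])
  qed (use h in \<open>auto simp: realizes_def\<close>)
  then show ?thesis using pred_partial_iso[OF countable_dom_expanded] by simp
next
  case False
  then have "realizes C a p \<longleftrightarrow> False" for C by (auto simp: realizes_def)
  then show ?thesis by simp
qed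

lemma pred_locally_modelled:
  "Measurable.pred (code_space expanded_vocab) (\<lambda>C :: (nat, 's + nat) struct. locally_modelled C)"
proof -
  let ?P = "\<lambda>C. \<forall>a. a \<in> lists (univ C) \<longrightarrow> (\<exists>p\<in>reps. realizes C a p \<and>
    (\<forall>y\<in>univ (fst p). \<exists>x. x \<in> univ C \<and> realizes C (a @ [x]) (fst p, snd p @ [y])))"
  have "Measurable.pred (code_space expanded_vocab) ?P"
    by (intro pred_intros_logic pred_intros_countable measurable_pred_countable[OF countable_reps]
        measurable_pred_countable[OF repsD(4)] pred_realizes pred_code_space pred_code_lists)
  moreover have "locally_modelled C \<longleftrightarrow> ?P C" if "C \<in> space (code_space expanded_vocab)" for C
  proof -
    have "locally_modelled C \<longleftrightarrow> C \<in> structures expanded_vocab \<and> ?P C"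
      unfolding locally_modelled_def Ball_def Bex_def by (rule refl)
    then show ?thesis using that unfolding space_code_space by blast
  qed
  ultimately show ?thesis by (simp cong: measurable_cong)
qed

text \<open>\<open>closure_in\<close> quantifies over all models and maps. When \<open>D\<close> is
  locally modelled, the tuple \<open>a @ [x]\<close> is realised in a representative, which leaves a
  countable disjunction; \<open>last\<close> and \<open>butlast\<close> recover the images of
  \<open>x\<close> and of \<open>a\<close>.\<close>

lemma in_closure_in_iff:
  assumes D: "locally_modelled D" and a: "set a \<subseteq> univ D"
  shows "x \<in> closure_in D (set a) \<longleftrightarrow>
    (\<exists>p\<in>{p \<in> reps. last (snd p) \<in> univ (cl le (fst p) (set (butlast (snd p))))}. realizes D (a @ [x]) p)"
proof
  assume x: "x \<in> closure_in D (set a)"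
  then have "a @ [x] \<in> lists (univ D)" using a closure_in_subset[of D "set a"] by auto
  then obtain p where p: "p \<in> reps" "realizes D (a @ [x]) p"
    using D unfolding locally_modelled_def by blast
  then obtain h where h: "map h (a @ [x]) = snd p"
    "partial_iso expanded_vocab h (insert x (set a)) D (expand (fst p))"
    by (auto simp: realizes_def)
  have "h x \<in> univ (cl le (fst p) (h ` set a))"
    by (rule closure_inD[OF x finite_set repsD(1)[OF p(1)] h(2)])
  moreover have "last (snd p) = h x" "set (butlast (snd p)) = h ` set a"
    using h(1)[symmetric] by simp_all
  ultimately have "p \<in> {p \<in> reps. last (snd p) \<in> univ (cl le (fst p) (set (butlast (snd p))))}"
    using p(1) by simp
  then show "\<exists>p\<in>{p \<in> reps. last (snd p) \<in> univ (cl le (fst p) (set (butlast (snd p))))}. realizes D (a @ [x]) p"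
    using p(2) by blast
next
  assume "\<exists>p\<in>{p \<in> reps. last (snd p) \<in> univ (cl le (fst p) (set (butlast (snd p))))}. realizes D (a @ [x]) p"
  then obtain p where p: "p \<in> reps" "last (snd p) \<in> univ (cl le (fst p) (set (butlast (snd p))))"
    and r: "realizes D (a @ [x]) p" by blast
  obtain h where h: "map h (a @ [x]) = snd p"
      "partial_iso expanded_vocab h (insert x (set a)) D (expand (fst p))"
    using r by (auto simp: realizes_def)
  have "last (snd p) = h x" "set (butlast (snd p)) = h ` set a"
    using h(1)[symmetric] by simp_all
  then show "x \<in> closure_in D (set a)"
    using closure_inI[OF repsD(1)[OF p(1)] h(2)] p(2) by simp
qed

lemma codes_expand_measurable:
  "codes expanded_vocab (expand ` K) \<in> sets (code_space expanded_vocab)"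
proof -
  have "codes expanded_vocab (expand ` K) =
      {C \<in> space (code_space expanded_vocab). locally_modelled C}"
    unfolding codes_expand space_code_space
    using locally_modelled_def[where ?'v = nat] by blast
  then show ?thesis using pred_locally_modelled by (simp add: pred_def)
qed

lemma codes_le_expand_measurable:
  "codes_le expanded_vocab (expansion_le le (expand ` K))
     \<in> sets (code_space expanded_vocab \<Otimes>\<^sub>M code_space expanded_vocab)"
proof -
  let ?S = "code_space expanded_vocab \<Otimes>\<^sub>M code_space expanded_vocab"
  let ?I = "{p \<in> reps. last (snd p) \<in> univ (cl le (fst p) (set (butlast (snd p))))}"
  let ?P = "\<lambda>C D. (substructure expanded_vocab C D \<and> locally_modelled D) \<and>
       (\<forall>a. a \<in> lists (univ C) \<longrightarrow> (\<forall>x. (\<exists>p\<in>?I. realizes D (a @ [x]) p) \<longrightarrow> x \<in> univ C))"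
  have *: "Measurable.pred ?S (\<lambda>p. Q (fst p))" "Measurable.pred ?S (\<lambda>p. Q (snd p))"
    if "Measurable.pred (code_space expanded_vocab) Q" for Q
    using measurable_compose[OF measurable_fst that] measurable_compose[OF measurable_snd that] by auto
  have I: "countable ?I" using countable_reps by (rule countable_subset[rotated]) auto
  have "Measurable.pred ?S (\<lambda>p. ?P (fst p) (snd p))"
    by (intro pred_intros_logic pred_intros_countable measurable_pred_countable[OF I]
        pred_substructure[OF countable_dom_expanded] *[OF pred_realizes]
        *[OF pred_code_univ] *[OF pred_code_lists] *[OF pred_locally_modelled])
  moreover have "codes_le expanded_vocab (expansion_le le (expand ` K)) =
      {p \<in> space ?S. ?P (fst p) (snd p)}"
  proof -
    have "(\<forall>a\<in>lists (univ C). closure_in D (set a) \<subseteq> univ C) \<longleftrightarrow>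
        (\<forall>a. a \<in> lists (univ C) \<longrightarrow> (\<forall>x. (\<exists>p\<in>?I. realizes D (a @ [x]) p) \<longrightarrow> x \<in> univ C))"
      if s: "substructure expanded_vocab C D" and D: "locally_modelled D"
      for C D :: "(nat, 's + nat) struct"
    proof -
      have "x \<in> closure_in D (set a) \<longleftrightarrow> (\<exists>p\<in>?I. realizes D (a @ [x]) p)"
        if "a \<in> lists (univ C)" for a x
        by (rule in_closure_in_iff[OF D]) (use that s in \<open>auto simp: substructure_def\<close>)
      then show ?thesis by blast
    qed
    moreover have "(C, D) \<in> space ?S" if "substructure expanded_vocab C D" for C D :: "(nat, 's + nat) struct"
      using that by (simp add: space_pair_measure space_code_space substructure_def)
    ultimately have "p \<in> {(C, D). substructure expanded_vocab C D \<and> locally_modelled D \<and>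
         (\<forall>a\<in>lists (univ C). closure_in D (set a) \<subseteq> univ C)} \<longleftrightarrow>
       p \<in> {p \<in> space ?S. ?P (fst p) (snd p)}" for p
      by (cases p) (simp only: mem_Collect_eq case_prod_conv fst_conv snd_conv, blast)
    then show ?thesis unfolding codes_le_expand by (rule set_eqI)
  qed
  ultimately show ?thesis by (simp add: pred_def)
qed

lemma borel_presented_expand:
  "borel_presented expanded_vocab (expand ` K) (expansion_le le (expand ` K))"
proof -
  have "|dom expanded_vocab| \<le>o natLeq"
    using countable_dom_expanded countable_card_le_natLeq by blast
  then show ?thesis
    using expansion_AEC[OF functorial_expansion_expand LST] codes_expand_measurable
      codes_le_expand_measurable
    by (simp add: borel_presented_def is_LS_number_natLeq)
qed

text \<open>A real \<open>z\<close> codes the interpretations of the new relation symbols.\<close>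

definition attach :: "(nat \<Rightarrow> nat) \<Rightarrow> (nat, 's) struct \<Rightarrow> (nat, 's + nat) struct" where
  "attach z C = \<lparr>univ = univ C,
     rels = case_sum (rels C) (\<lambda>t. {xs \<in> lists (univ C). arity t = length xs \<and> z (to_nat (t, xs)) = 1}),
     funs = case_sum (funs C) (\<lambda>t xs. undefined)\<rparr>"

lemma univ_attach [simp]: "univ (attach z C) = univ C"
  by (simp add: attach_def)

lemma reduct_attach [simp]: "reduct (attach z C) = C"
  by (simp add: reduct_def attach_def)

lemma attach_in_structures:
  assumes C: "C \<in> structures \<tau>"
  shows "attach z C \<in> structures expanded_vocab"
proof -
  have "xs \<in> lists (univ C) \<and> expanded_vocab s = Some (Rel (length xs))"
    if "xs \<in> rels (attach z C) s" for s xs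
    using that structures_relD[OF C] by (cases s) (auto simp: attach_def)
  moreover have "if xs \<in> lists (univ C) \<and> expanded_vocab s = Some (Fun (length xs))
      then funs (attach z C) s xs \<in> univ C else funs (attach z C) s xs = undefined" for s xs
    using structures_funD[OF C, of xs] structures_fun_undefined[OF C, of xs]
    by (cases s) (simp_all add: attach_def)
  ultimately show ?thesis unfolding structures_def by simp
qed

lemma attach_iso:
  assumes f: "struct_iso \<tau> f C N" and N: "N \<in> K"
    and z: "\<And>t xs. xs \<in> lists (univ C) \<Longrightarrow> z (to_nat (t, xs)) = 1 \<longleftrightarrow> tp N (map f xs) = t"
  shows "struct_iso expanded_vocab f (attach z C) (expand N)"
proof -
  note D = partial_isoD[OF struct_isoD(3)[OF f]]
  have "partial_iso expanded_vocab f (univ C) (attach z C) (expand N)"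
  proof (rule partial_isoI)
    fix s xs assume xs: "xs \<in> lists (univ C)"
    have fxs: "map f xs \<in> lists (univ N)" by (rule map_in_lists[OF xs D(3)])
    show "xs \<in> rels (attach z C) s \<longleftrightarrow> map f xs \<in> rels (expand N) s"
      if "expanded_vocab s = Some (Rel (length xs))"
      using that D(4)[OF xs] z[OF xs] xs fxs by (cases s) (simp_all add: expand_def attach_def)
    show "funs (attach z C) s xs = y \<longleftrightarrow> funs (expand N) s (map f xs) = f y"
      if "expanded_vocab s = Some (Fun (length xs))" "y \<in> univ C" for y
      using that D(5)[OF xs] by (cases s) (simp_all add: expand_def attach_def)
  qed (use D in simp_all)
  then show ?thesis
    using attach_in_structures[OF struct_isoD(1)[OF f]] expand_in_structures[OF N] struct_isoD(4)[OF f]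
    by (simp add: struct_iso_iff)
qed

lemma ex_attach:
  fixes f :: "nat \<Rightarrow> 'u"
  obtains z :: "nat \<Rightarrow> nat"
  where "\<And>t xs. z (to_nat (t, xs)) = 1 \<longleftrightarrow> tp N (map f xs) = t"
proof
  fix t :: nat and xs :: "nat list"
  show "(\<lambda>n. case from_nat n of (t, xs) \<Rightarrow> if tp N (map f xs) = t then 1 else 0) (to_nat (t, xs)) = (1::nat)
    \<longleftrightarrow> tp N (map f xs) = t" by simp
qed

lemma attach_measurable:
  "(\<lambda>p. attach (snd p) (fst p)) \<in> code_space \<tau> \<Otimes>\<^sub>M borel \<rightarrow>\<^sub>M code_space expanded_vocab"
proof -
  let ?S = "code_space \<tau> \<Otimes>\<^sub>M (borel :: (nat \<Rightarrow> nat) measure)"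
  have *: "Measurable.pred ?S (\<lambda>p. Q (fst p))" if "Measurable.pred (code_space \<tau>) Q" for Q
    using measurable_compose[OF measurable_fst that] by auto
  have z: "Measurable.pred ?S (\<lambda>p. snd p n = 1)" for n
  proof -
    have "(\<lambda>z :: nat \<Rightarrow> nat. z n) \<in> borel \<rightarrow>\<^sub>M borel" by measurable
    then have "(\<lambda>p. snd p n) \<in> ?S \<rightarrow>\<^sub>M borel" by (rule measurable_compose[OF measurable_snd])
    then show ?thesis by measurable
  qed
  show ?thesis
    unfolding code_space_def[of expanded_vocab]
  proof (rule measurable_measure_of[OF code_space_generators])
    show "(\<lambda>p. attach (snd p) (fst p)) \<in> space ?S \<rightarrow> structures expanded_vocab"
      using attach_in_structures by (auto simp: space_pair_measure space_code_space)
    have pre: "(\<lambda>p. attach (snd p) (fst p)) -` {C \<in> structures expanded_vocab. Q C} \<inter> space ?S \<in> sets ?S"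
      if "Measurable.pred ?S (\<lambda>p. Q (attach (snd p) (fst p)))" for Q
    proof -
      have "(\<lambda>p. attach (snd p) (fst p)) -` {C \<in> structures expanded_vocab. Q C} \<inter> space ?S =
        {p \<in> space ?S. Q (attach (snd p) (fst p))}"
        using attach_in_structures by (auto simp: space_pair_measure space_code_space)
      then show ?thesis using that by (simp add: pred_def)
    qed
    have u: "Measurable.pred ?S (\<lambda>p. a \<in> univ (attach (snd p) (fst p)))" for a
      using *[OF pred_code_univ] by simp
    have r: "Measurable.pred ?S (\<lambda>p. xs \<in> rels (attach (snd p) (fst p)) s)" for xs s
    proof (cases s)
      case (Inl t) then show ?thesis using *[OF pred_code_rels] by (simp add: attach_def)
    next
      case (Inr t)
      then show ?thesis
        using pred_intros_logic(3)[OF *[OF pred_code_lists, of xs] pred_intros_logic(3)[OF pred_constant z]]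
        by (simp add: attach_def)
    qed
    have f: "Measurable.pred ?S (\<lambda>p. xs \<in> lists (univ (attach (snd p) (fst p))) \<and>
        funs (attach (snd p) (fst p)) s xs = y)" for xs s y
    proof (cases s)
      case (Inl t) then show ?thesis using *[OF pred_code_funs] by (simp add: attach_def)
    next
      case (Inr t)
      then show ?thesis
        using pred_intros_logic(3)[OF *[OF pred_code_lists, of xs] pred_constant]
        by (simp add: attach_def)
    qed
    fix Y :: "(nat, 's + nat) struct set"
    assume "Y \<in> {{C \<in> structures expanded_vocab. a \<in> univ C} |a. True} \<union>
      {{C \<in> structures expanded_vocab. xs \<in> rels C s} |s xs. True} \<union>
      {{C \<in> structures expanded_vocab. xs \<in> lists (univ C) \<and> funs C s xs = a} |s xs a. True}"
    then show "(\<lambda>p. attach (snd p) (fst p)) -` Y \<inter> space ?S \<in> sets ?S"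
      using pre[OF u] pre[OF r] pre[OF f] by blast
  qed
qed

text \<open>The witness \<open>z\<close> is pulled back from the types of a model along an
  isomorphism. Conversely, the reduct of a code for the expanded class is a code for the original
  one.\<close>

lemma analytic_codes: "analytic_in (code_space \<tau>) (codes \<tau> K)"
  unfolding analytic_in_def
proof
  let ?S = "code_space \<tau> \<Otimes>\<^sub>M (borel :: (nat \<Rightarrow> nat) measure)"
  let ?B = "(\<lambda>p. attach (snd p) (fst p)) -` codes expanded_vocab (expand ` K) \<inter> space ?S"
  show "?B \<in> sets ?S" by (rule measurable_sets[OF attach_measurable codes_expand_measurable])
  show "codes \<tau> K = fst ` ?B"
  proof (intro set_eqI iffI)
    fix C assume "C \<in> codes \<tau> K"
    then obtain N f where N: "N \<in> K" and f: "struct_iso \<tau> f C N" by (auto simp: codes_def)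
    obtain z :: "nat \<Rightarrow> nat" where z: "\<And>t xs. z (to_nat (t, xs)) = 1 \<longleftrightarrow> tp N (map f xs) = t"
      using ex_attach[of N f] by blast
    have "struct_iso expanded_vocab f (attach z C) (expand N)" by (rule attach_iso[OF f N z])
    then have "attach z C \<in> codes expanded_vocab (expand ` K)" using N by (auto simp: codes_def)
    then have "(C, z) \<in> ?B"
      using struct_isoD(1)[OF f] by (simp add: space_pair_measure space_code_space)
    then show "C \<in> fst ` ?B" by force
  next
    fix C assume "C \<in> fst ` ?B"
    then obtain z where "attach z C \<in> codes expanded_vocab (expand ` K)" by auto
    then obtain N f where N: "N \<in> K" and f: "struct_iso expanded_vocab f (attach z C) (expand N)"
      by (auto simp: codes_def)
    have "struct_iso \<tau> f C N" using struct_iso_reduct[OF f, of \<tau>] by simp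
    then show "C \<in> codes \<tau> K" using N by (auto simp: codes_def)
  qed
qed

lemma analytic_codes_le: "analytic_in (code_space \<tau> \<Otimes>\<^sub>M code_space \<tau>) (codes_le \<tau> le)"
  unfolding analytic_in_def
proof
  let ?S = "(code_space \<tau> \<Otimes>\<^sub>M code_space \<tau>) \<Otimes>\<^sub>M (borel :: (nat \<Rightarrow> nat) measure)"
  let ?g = "\<lambda>q. (attach (snd q) (fst (fst q)), attach (snd q) (snd (fst q)))"
  let ?B = "?g -` codes_le expanded_vocab (expansion_le le (expand ` K)) \<inter> space ?S"
  have "(\<lambda>q. attach (snd q) (fst (fst q))) \<in> ?S \<rightarrow>\<^sub>M code_space expanded_vocab"
    "(\<lambda>q. attach (snd q) (snd (fst q))) \<in> ?S \<rightarrow>\<^sub>M code_space expanded_vocab"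
    using measurable_compose[of "\<lambda>q. (fst (fst q), snd q)" ?S, OF _ attach_measurable]
      measurable_compose[of "\<lambda>q. (snd (fst q), snd q)" ?S, OF _ attach_measurable]
    by simp_all
  then have "?g \<in> ?S \<rightarrow>\<^sub>M code_space expanded_vocab \<Otimes>\<^sub>M code_space expanded_vocab" by simp
  then show "?B \<in> sets ?S" using codes_le_expand_measurable by (rule measurable_sets)
  show "codes_le \<tau> le = fst ` ?B"
  proof (intro set_eqI iffI)
    fix p assume "p \<in> codes_le \<tau> le"
    then obtain C D M N f where p: "p = (C, D)" and CD: "univ C \<subseteq> univ D" and le: "(M, N) \<in> le"
      and fC: "struct_iso \<tau> f C M" and fD: "struct_iso \<tau> f D N"
      by (auto simp: codes_le_def)
    \<comment> \<open>One \<open>z\<close> serves both structures: it is built from the types in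
      \<open>N\<close>, and by \<open>tp_sub\<close> these are also the types in
      \<open>M\<close>.\<close>
    obtain z :: "nat \<Rightarrow> nat" where z: "\<And>t xs. z (to_nat (t, xs)) = 1 \<longleftrightarrow> tp N (map f xs) = t"
      using ex_attach[of N f] by blast
    have "tp M (map f xs) = tp N (map f xs)" if "xs \<in> lists (univ C)" for xs
      by (rule tp_sub[OF le]) (use that struct_isoD(4)[OF fC] in auto)
    then have "struct_iso expanded_vocab f (attach z C) (expand M)"
      using z by (intro attach_iso[OF fC le_in_K(1)[OF le]]) simp
    moreover have "struct_iso expanded_vocab f (attach z D) (expand N)"
      by (rule attach_iso[OF fD le_in_K(2)[OF le] z])
    moreover have "(expand M, expand N) \<in> expansion_le le (expand ` K)"
      using le le_in_K[OF le] by (simp add: expansion_le_def)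
    ultimately have "?g (p, z) \<in> codes_le expanded_vocab (expansion_le le (expand ` K))"
      using CD p unfolding codes_le_def by auto
    then have "(p, z) \<in> ?B"
      using struct_isoD(1)[OF fC] struct_isoD(1)[OF fD] p
      by (simp add: space_pair_measure space_code_space)
    then show "p \<in> fst ` ?B" by force
  next
    fix p assume "p \<in> fst ` ?B"
    then obtain C D z where p: "p = (C, D)"
      and "(attach z C, attach z D) \<in> codes_le expanded_vocab (expansion_le le (expand ` K))" by auto
    then obtain M N f where CD: "univ C \<subseteq> univ D" and le: "(M, N) \<in> le"
      and fC: "struct_iso expanded_vocab f (attach z C) (expand M)"
      and fD: "struct_iso expanded_vocab f (attach z D) (expand N)"
      by (auto simp: codes_le_def expansion_le_def)
    have "struct_iso \<tau> f C M" "struct_iso \<tau> f D N"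
      using struct_iso_reduct[OF fC, of \<tau>] struct_iso_reduct[OF fD, of \<tau>] by simp_all
    then show "p \<in> codes_le \<tau> le" using p CD le by (auto simp: codes_le_def)
  qed
qed

lemma analytically_presented: "analytically_presented \<tau> K le"
  using AEC LST analytic_codes analytic_codes_le
  by (simp add: analytically_presented_def is_LS_number_natLeq)

end

section \<open>Representatives of isomorphism types and the conclusion\<close>

lemma iso_types_representatives:
  assumes S: "C \<subseteq> structures \<tau>" and c: "countable (iso_types \<tau> C)"
  obtains R where "countable R" "R \<subseteq> C" "\<And>M. M \<in> C \<Longrightarrow> \<exists>N\<in>R. \<exists>f. struct_iso \<tau> f M N"
proof -
  define r where "r = {(M, N). M \<in> C \<and> N \<in> C \<and> (\<exists>f. struct_iso \<tau> f M N)}"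
  have ne: "M \<in> r `` {M}" if "M \<in> C" for M
    using that struct_iso_refl S unfolding r_def by blast
  define R where "R = (\<lambda>c. SOME N. N \<in> c) ` iso_types \<tau> C"
  have in_R: "\<exists>N\<in>R. (M, N) \<in> r" if M: "M \<in> C" for M
  proof -
    have "r `` {M} \<in> iso_types \<tau> C" unfolding iso_types_def r_def[symmetric] using M by (rule quotientI)
    moreover have "(SOME N. N \<in> r `` {M}) \<in> r `` {M}" using ne[OF M] by (rule someI)
    ultimately show ?thesis unfolding R_def by blast
  qed
  show thesis
  proof
    show "countable R" unfolding R_def using c by simp
    show "R \<subseteq> C"
    proof
      fix N assume "N \<in> R"
      then obtain M where M: "M \<in> C" "N = (SOME N. N \<in> r `` {M})"
        unfolding R_def iso_types_def r_def[symmetric] by (auto elim: quotientE)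
      have "N \<in> r `` {M}" unfolding M(2) using ne[OF M(1)] by (rule someI)
      then show "N \<in> C" by (auto simp: r_def)
    qed
    show "\<exists>N\<in>R. \<exists>f. struct_iso \<tau> f M N" if "M \<in> C" for M
      using in_R[OF that] by (auto simp: r_def)
  qed
qed

theorem corollary3p14:
  fixes \<tau> :: "'s vocab" and K :: "('u, 's) struct set" and le :: "('u, 's) struct rel"
  assumes "AEC \<tau> K le"
    and "has_intersections K le"
    and "is_LS_number \<tau> K le natLeq"
    and "|iso_types \<tau> (models_of_card K natLeq)| \<le>o natLeq"
    and "|iso_types \<tau> {M \<in> K. finite (univ M)}| \<le>o natLeq"
  shows "(\<exists>(\<tau>' :: ('s + nat) vocab) (K' :: ('u, 's + nat) struct set).
            functorial_expansion \<tau> K le \<tau>' K' \<and>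
            borel_presented \<tau>' K' (expansion_le le K')) \<and>
         analytically_presented \<tau> K le"
proof -
  interpret aec_with_intersections \<tau> K le
    by unfold_locales (use assms(1-3) in \<open>simp_all add: is_LS_number_natLeq\<close>)
  \<comment> \<open>\<open>?A\<close> consists of the countably infinite models only, so
    representatives of the finite ones are collected separately and the two families are
    united.\<close>
  let ?A = "models_of_card K natLeq" and ?F = "{M \<in> K. finite (univ M)}"
  have AS: "?A \<subseteq> structures \<tau>" "?F \<subseteq> structures \<tau>"
    using K_structures by (auto simp: models_of_card_def)
  have cA: "countable (iso_types \<tau> ?A)" and cF: "countable (iso_types \<tau> ?F)"
    using assms(4,5) by (simp_all only: countable_card_le_natLeq)
  obtain R1 where R1: "countable R1" "R1 \<subseteq> ?A" "\<And>M. M \<in> ?A \<Longrightarrow> \<exists>N\<in>R1. \<exists>f. struct_iso \<tau> f M N"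
    by (rule iso_types_representatives[OF AS(1) cA]) (rule that)
  obtain R2 where R2: "countable R2" "R2 \<subseteq> ?F" "\<And>M. M \<in> ?F \<Longrightarrow> \<exists>N\<in>R2. \<exists>f. struct_iso \<tau> f M N"
    by (rule iso_types_representatives[OF AS(2) cF]) (rule that)
  interpret aec_countable_types \<tau> K le "R1 \<union> R2"
  proof
    show "countable (R1 \<union> R2)" using R1(1) R2(1) by simp
    show "R1 \<union> R2 \<subseteq> K" using R1(2) R2(2) by (auto simp: models_of_card_def)
    fix M
    show "countable (univ M)" if "M \<in> R1 \<union> R2"
    proof (cases "M \<in> R2")
      case True then show ?thesis using R2(2) by (auto intro: countable_finite)
    next
      case False
      then have "(card_of (univ M), natLeq) \<in> ordIso" using that R1(2) by (auto simp: models_of_card_def)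
      then show ?thesis using countable_card_le_natLeq ordIso_imp_ordLeq by blast
    qed
    assume M: "M \<in> K" "countable (univ M)"
    show "\<exists>N\<in>R1 \<union> R2. \<exists>f. struct_iso \<tau> f M N"
    proof (cases "finite (univ M)")
      case True then show ?thesis using R2(3) M(1) by blast
    next
      case False
      have "(card_of (univ M), card_of (UNIV :: nat set)) \<in> ordIso"
        using card_of_ordIsoI[OF to_nat_on_infinite[OF M(2) False]] .
      then have "(card_of (univ M), natLeq) \<in> ordIso" using card_of_nat ordIso_transitive by blast
      then have "M \<in> ?A" using M(1) by (simp add: models_of_card_def)
      then show ?thesis using R1(3) by blast
    qed
  qed
  show ?thesis
    using functorial_expansion_expand borel_presented_expand analytically_presented by blast
qed

end
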